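(* Let $N\ge3$ and $2^*=\frac{2N}{N-2}$. Suppose that $(u_n)\subset\mathcal{D}^{1,2}(\mathbb{R}^N)$ is bounded and for some $r>0$ $$\lim_{n\to\infty}\sup_{y\in\mathbb{R}^N}\int_{B(y,r)}|u_n|^2\,dx=0.$$ Then $$\int_{\mathbb{R}^N}\Psi(u_n)\,dx\to0\quad\text{as }n\to\infty$$ for any continuous $\Psi:\mathbb{R}\to[0,\infty)$ such that $$\lim_{s\to0}\frac{\Psi(s)}{|s|^{2^*}}=\lim_{|s|\to\infty}\frac{\Psi(s)}{|s|^{2^*}}=0.$$
   Context: $\mathcal{D}^{1,2}(\mathbb{R}^N)$ is the completion of $\mathcal{C}_0^\infty(\mathbb{R}^N)$ with respect to the norm $\|u\|=\big(\int_{\mathbb{R}^N}|\nabla u|^2\,dx\big)^{1/2}$. $B(y,r)$ is the ball in $\mathbb{R}^N$ of center $y$ and radius $r$. *)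

theory Defs
  imports "HOL-Analysis.Analysis"
begin

text \<open>The Sobolev exponent \<open>2\<^sup>*\<close>; meaningful for \<open>N \<ge> 3\<close>.\<close>

definition crit_exp :: "nat \<Rightarrow> real" where
  "crit_exp N = 2 * real N / (real N - 2)"

definition partial :: "'n::finite \<Rightarrow> (real ^ 'n \<Rightarrow> real) \<Rightarrow> real ^ 'n \<Rightarrow> real" where
  "partial i f x = frechet_derivative f (at x) (axis i 1)"

definition grad :: "(real ^ 'n::finite \<Rightarrow> real) \<Rightarrow> real ^ 'n \<Rightarrow> real ^ 'n" where
  "grad f x = (\<chi> i. partial i f x)"

primrec Ck :: "nat \<Rightarrow> (real ^ 'n::finite \<Rightarrow> real) \<Rightarrow> bool" where
  "Ck 0 f \<longleftrightarrow> continuous_on UNIV f"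
| "Ck (Suc k) f \<longleftrightarrow> (\<forall>x. f differentiable (at x)) \<and> (\<forall>i. Ck k (partial i f))"

definition test_functions :: "(real ^ 'n::finite \<Rightarrow> real) set" where
  "test_functions = {f. (\<forall>k. Ck k f) \<and> compact (closure {x. f x \<noteq> 0})}"

text \<open>
  The space \<open>D\<^sup>1\<^sup>,\<^sup>2\<close> is the completion of the test functions in the norm
  \<open>(\<integral>|\<nabla>u|\<^sup>2)\<^sup>1\<^sup>/\<^sup>2\<close>. By the Sobolev inequality (\<open>N \<ge> 3\<close>) a sequence of test
  functions that is Cauchy in this norm converges in \<open>L\<close> with exponent \<open>2\<^sup>*\<close>, and the
  completion is, as usual, identified with the space of these limits. As \<open>L\<^sup>2\<close> is complete,
  being Cauchy in the norm amounts to \<open>L\<^sup>2\<close> convergence of the gradients to some \<open>g\<close>.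
  Elements are Lebesgue measurable functions; equality almost everywhere is not quotiented out.
\<close>

definition D12_approx ::
  "(nat \<Rightarrow> real ^ 'n::finite \<Rightarrow> real) \<Rightarrow> (real ^ 'n \<Rightarrow> real) \<Rightarrow> (real ^ 'n \<Rightarrow> real ^ 'n) \<Rightarrow> bool" where
  "D12_approx \<phi> u g \<longleftrightarrow>
     (\<forall>k. \<phi> k \<in> test_functions) \<and>
     u \<in> borel_measurable lebesgue \<and> g \<in> borel_measurable lebesgue \<and>
     (\<lambda>k. \<integral>\<^sup>+ x. ennreal (\<bar>\<phi> k x - u x\<bar> powr crit_exp CARD('n)) \<partial>lebesgue) \<longlonglongrightarrow> 0 \<and>
     (\<lambda>k. \<integral>\<^sup>+ x. ennreal ((norm (grad (\<phi> k) x - g x))\<^sup>2) \<partial>lebesgue) \<longlonglongrightarrow> 0"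

definition D12 :: "(real ^ 'n::finite \<Rightarrow> real) set" where
  "D12 = {u. \<exists>\<phi> g. D12_approx \<phi> u g}"

text \<open>
  The gradient of an element of the completion. It is the distributional gradient, hence does
  not depend, up to null sets, on the approximating sequence. The norm is the limit of the
  norms of the approximating test functions, that is, the \<open>L\<^sup>2\<close> norm of this gradient.
\<close>

definition D12_grad :: "(real ^ 'n::finite \<Rightarrow> real) \<Rightarrow> real ^ 'n \<Rightarrow> real ^ 'n" where
  "D12_grad u = (SOME g. \<exists>\<phi>. D12_approx \<phi> u g)"

definition D12_norm :: "(real ^ 'n::finite \<Rightarrow> real) \<Rightarrow> real" where
  "D12_norm u = sqrt (LINT x|lebesgue. (norm (D12_grad u x))\<^sup>2)"

end

theory Submission
  imports Defs
begin

text \<open>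
  Averaging \<open>v(x)\<^sup>2 \<le> 2 (v(x + h) - v(x))\<^sup>2 + 2 v(x + h)\<^sup>2\<close> over \<open>|h| < a\<close> and using
  \<open>\<integral>|v(x + h) - v(x)|\<^sup>2 dx \<le> |h|\<^sup>2 \<integral>|\<nabla>v|\<^sup>2\<close> shows that \<open>{|v| \<ge> c}\<close> has measure at most
  \<open>4 a\<^sup>2 c\<^sup>-\<^sup>2 \<integral>|\<nabla>v|\<^sup>2\<close>, as soon as the mean of \<open>v\<^sup>2\<close> over balls of radius \<open>a\<close> is at most
  \<open>c\<^sup>2/4\<close>. This estimate is used twice.

  Applied to truncations of a test function between dyadic levels \<open>\<lambda>\<close> and \<open>2\<lambda>\<close>, with \<open>a\<close> so large
  that Chebyshev's inequality controls the mean, and summed over the levels, it gives the Sobolev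
  inequality. So \<open>(u\<^sub>n)\<close> is bounded in \<open>L\<close> with exponent \<open>2\<^sup>*\<close>.

  Applied to \<open>u\<^sub>n\<close> itself with \<open>a\<close> small, the hypothesis on local masses gives
  \<open>|{|u\<^sub>n| \<ge> \<delta>}| \<rightarrow> 0\<close> for every \<open>\<delta> > 0\<close>. As \<open>\<Psi>(s)\<close> is at most \<open>\<epsilon>|s|\<close> to the power \<open>2\<^sup>*\<close>, plus a constant
  where \<open>|s| \<ge> \<delta>\<close>, the claim follows. Both applications are made to test functions that approximate \<open>u\<^sub>n\<close>.
\<close>

subsection \<open>Superlevel sets and the gradient\<close>

text \<open>This is nonnegativity of a variance: with \<open>m\<close> the mean of \<open>f\<close>,
  the integral of \<open>(f t - m)\<^sup>2\<close> over the unit interval is the difference of the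
  two sides.\<close>

lemma integral_power2_le:
  fixes f :: "real \<Rightarrow> real"
  assumes "continuous_on {0..1} f"
  shows "(integral {0..1} f)\<^sup>2 \<le> integral {0..1} (\<lambda>t. (f t)\<^sup>2)"
proof -
  define m where "m = integral {0..1} f"
  have [simp]: "f integrable_on {0..1}" "(\<lambda>t. (f t)\<^sup>2) integrable_on {0..1}"
    using assms by (auto intro!: integrable_continuous_real continuous_intros)
  have "((\<lambda>t. ((f t)\<^sup>2 - 2 * m * f t) + m\<^sup>2) has_integral
      (integral {0..1} (\<lambda>t. (f t)\<^sup>2) - 2 * m * m) + (1 - 0) *\<^sub>R m\<^sup>2) {0..1}"
    unfolding m_def using has_integral_const_real[of "m\<^sup>2" 0 1]
    by (intro has_integral_add has_integral_diff has_integral_mult_right integrable_integral) (simp_all add: m_def)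
  hence "((\<lambda>t. (f t - m)\<^sup>2) has_integral (integral {0..1} (\<lambda>t. (f t)\<^sup>2) - m\<^sup>2)) {0..1}"
    by (simp add: power2_eq_square algebra_simps)
  hence "0 \<le> integral {0..1} (\<lambda>t. (f t)\<^sup>2) - m\<^sup>2"
    by (rule has_integral_nonneg) simp
  thus ?thesis by (simp add: m_def)
qed

lemma nn_integral_lborel_translate:
  fixes f :: "'a::euclidean_space \<Rightarrow> ennreal"
  assumes "f \<in> borel_measurable borel"
  shows "(\<integral>\<^sup>+x. f (x + c) \<partial>lborel) = (\<integral>\<^sup>+x. f x \<partial>lborel)"
proof -
  have "(\<integral>\<^sup>+x. f x \<partial>lborel) = (\<integral>\<^sup>+x. f x \<partial>distr lborel borel ((+) c))"
    by (simp add: lborel_distr_plus)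
  also have "\<dots> = (\<integral>\<^sup>+x. f (x + c) \<partial>lborel)"
    using assms by (subst nn_integral_distr) (auto simp: add.commute)
  finally show ?thesis by simp
qed

text \<open>The increment of \<open>v\<close> is the integral of \<open>g \<bullet> h\<close> along
  the segment from \<open>x\<close> to \<open>x + h\<close>; Jensen and Cauchy-Schwarz give the
  bound. The right side is a nonnegative integral over \<open>lborel\<close>, ready for
  Tonelli.\<close>

lemma power2_diff_translate_le:
  fixes v :: "'a::euclidean_space \<Rightarrow> real"
  assumes v: "\<And>x. (v has_derivative (\<lambda>h. g x \<bullet> h)) (at x)" and g: "continuous_on UNIV g"
  shows "ennreal ((v (x + h) - v x)\<^sup>2) \<le>
    ennreal ((norm h)\<^sup>2) * (\<integral>\<^sup>+t. ennreal ((norm (g (x + t *\<^sub>R h)))\<^sup>2) * indicator {0..1} t \<partial>lborel)"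
proof -
  have c: "continuous_on S (\<lambda>t. g (x + t *\<^sub>R h))" for S
    by (rule continuous_on_compose2[OF g]) (auto intro!: continuous_intros)
  have D: "((\<lambda>t. v (x + t *\<^sub>R h)) has_vector_derivative g (x + t *\<^sub>R h) \<bullet> h) (at t within {0..1})" for t
  proof -
    have "((\<lambda>t. x + t *\<^sub>R h) has_derivative (\<lambda>s. s *\<^sub>R h)) (at t within {0..1})"
      by (auto intro!: derivative_eq_intros)
    from has_derivative_compose[OF this v] show ?thesis
      by (simp add: has_vector_derivative_def)
  qed
  have "((\<lambda>t. g (x + t *\<^sub>R h) \<bullet> h) has_integral v (x + 1 *\<^sub>R h) - v (x + 0 *\<^sub>R h)) {0..1}"
    by (rule fundamental_theorem_of_calculus) (auto intro: D)
  hence "(v (x + h) - v x)\<^sup>2 = (integral {0..1} (\<lambda>t. g (x + t *\<^sub>R h) \<bullet> h))\<^sup>2"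
    by (simp add: integral_unique)
  also have "\<dots> \<le> integral {0..1} (\<lambda>t. (g (x + t *\<^sub>R h) \<bullet> h)\<^sup>2)"
    by (rule integral_power2_le) (intro continuous_intros c)
  also have "\<dots> \<le> integral {0..1} (\<lambda>t. (norm h)\<^sup>2 * (norm (g (x + t *\<^sub>R h)))\<^sup>2)"
  proof (rule integral_le)
    fix t :: real
    have "\<bar>g (x + t *\<^sub>R h) \<bullet> h\<bar>\<^sup>2 \<le> (norm (g (x + t *\<^sub>R h)) * norm h)\<^sup>2"
      by (rule power_mono[OF Cauchy_Schwarz_ineq2]) simp
    thus "(g (x + t *\<^sub>R h) \<bullet> h)\<^sup>2 \<le> (norm h)\<^sup>2 * (norm (g (x + t *\<^sub>R h)))\<^sup>2"
      by (simp add: power_mult_distrib mult.commute)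
  qed (intro integrable_continuous_real continuous_intros c)+
  also have "\<dots> = (norm h)\<^sup>2 * integral {0..1} (\<lambda>t. (norm (g (x + t *\<^sub>R h)))\<^sup>2)"
    by simp
  finally have "(v (x + h) - v x)\<^sup>2 \<le> (norm h)\<^sup>2 * integral {0..1} (\<lambda>t. (norm (g (x + t *\<^sub>R h)))\<^sup>2)" .
  moreover have "ennreal (integral {0..1} (\<lambda>t. (norm (g (x + t *\<^sub>R h)))\<^sup>2)) =
     (\<integral>\<^sup>+t. ennreal ((norm (g (x + t *\<^sub>R h)))\<^sup>2) * indicator {0..1} t \<partial>lborel)"
    by (subst nn_integral_has_integral_lebesgue[symmetric, OF _ integrable_integral])
      (auto intro!: integrable_continuous_real continuous_intros c nn_integral_cong
            simp: indicator_def ennreal_mult' mult.commute)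
  ultimately show ?thesis
    by (metis ennreal_leI ennreal_mult' zero_le_power2)
qed

text \<open>Tonelli moves the integral in \<open>x\<close> inside, where translation invariance
  removes the shift \<open>t *\<^sub>R h\<close>; what remains is constant in \<open>t\<close> on an
  interval of length one.\<close>

lemma nn_integral_power2_diff_translate_le:
  fixes v :: "'a::euclidean_space \<Rightarrow> real"
  assumes v: "\<And>x. (v has_derivative (\<lambda>h. g x \<bullet> h)) (at x)" and g: "continuous_on UNIV g"
  shows "(\<integral>\<^sup>+x. ennreal ((v (x + h) - v x)\<^sup>2) \<partial>lborel) \<le>
    ennreal ((norm h)\<^sup>2) * (\<integral>\<^sup>+x. ennreal ((norm (g x))\<^sup>2) \<partial>lborel)"
proof -
  have [measurable]: "g \<in> borel_measurable borel"
    using g by (rule borel_measurable_continuous_onI)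
  have "(\<integral>\<^sup>+x. ennreal ((v (x + h) - v x)\<^sup>2) \<partial>lborel) \<le>
    (\<integral>\<^sup>+x. ennreal ((norm h)\<^sup>2) *
      (\<integral>\<^sup>+t. ennreal ((norm (g (x + t *\<^sub>R h)))\<^sup>2) * indicator {0..1} t \<partial>lborel) \<partial>lborel)"
    by (intro nn_integral_mono power2_diff_translate_le assms)
  also have "\<dots> = ennreal ((norm h)\<^sup>2) * (\<integral>\<^sup>+x.
      (\<integral>\<^sup>+t. ennreal ((norm (g (x + t *\<^sub>R h)))\<^sup>2) * indicator {0..1} t \<partial>lborel) \<partial>lborel)"
    by (rule nn_integral_cmult) measurable
  also have "(\<integral>\<^sup>+x. (\<integral>\<^sup>+t. ennreal ((norm (g (x + t *\<^sub>R h)))\<^sup>2) * indicator {0..1} t \<partial>lborel) \<partial>lborel)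
    = (\<integral>\<^sup>+t. (\<integral>\<^sup>+x. ennreal ((norm (g (x + t *\<^sub>R h)))\<^sup>2) * indicator {0..1} t \<partial>lborel) \<partial>lborel)"
    by (rule lborel_pair.Fubini') measurable
  also have "\<dots> = (\<integral>\<^sup>+t. (\<integral>\<^sup>+x. ennreal ((norm (g x))\<^sup>2) \<partial>lborel) * indicator {0..1} (t::real) \<partial>lborel)"
    by (subst nn_integral_multc) (auto simp: nn_integral_lborel_translate[of "\<lambda>x. ennreal ((norm (g x))\<^sup>2)"])
  also have "\<dots> = (\<integral>\<^sup>+x. ennreal ((norm (g x))\<^sup>2) \<partial>lborel)"
    by (subst nn_integral_cmult_indicator) auto
  finally show ?thesis .
qed

text \<open>Only a continuous gradient is assumed, so that a \<open>C^1\<close> truncation of a test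
  function qualifies as well as the test function itself.\<close>

lemma superlevel_measure_le:
  fixes v :: "'a::euclidean_space \<Rightarrow> real"
  assumes v: "\<And>x. (v has_derivative (\<lambda>h. g x \<bullet> h)) (at x)" and g: "continuous_on UNIV g"
    and S: "S \<in> sets borel" and "a > 0" "c > 0"
    and large: "\<And>x. x \<in> S \<Longrightarrow> c \<le> \<bar>v x\<bar>"
    and small: "\<And>x. x \<in> S \<Longrightarrow>
      (\<integral>\<^sup>+y. ennreal ((v y)\<^sup>2) * indicator (ball x a) y \<partial>lborel)
        \<le> ennreal (c\<^sup>2 / 4) * emeasure lborel (ball (0::'a) a)"
  shows "ennreal (c\<^sup>2) * emeasure lborel S \<le>
    ennreal (4 * a\<^sup>2) * (\<integral>\<^sup>+x. ennreal ((norm (g x))\<^sup>2) \<partial>lborel)"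
proof -
  define B where "B = ball (0::'a) a"
  define m where "m = unit_ball_vol (real DIM('a)) * a ^ DIM('a)"
  have m: "m > 0" using \<open>a > 0\<close> by (simp add: m_def)
  have eB: "emeasure lborel B = ennreal m"
    using \<open>a > 0\<close> by (simp add: B_def m_def emeasure_ball)
  have "continuous_on UNIV v"
    using v by (auto intro!: continuous_at_imp_continuous_on has_derivative_continuous)
  hence [measurable]: "v \<in> borel_measurable borel"
    by (rule borel_measurable_continuous_onI)
  have [measurable]: "S \<in> sets borel" "B \<in> sets borel" using S by (auto simp: B_def)
  let ?d = "\<lambda>x h. ennreal ((v (x + h) - v x)\<^sup>2) * indicator B h"
  let ?G = "\<integral>\<^sup>+x. ennreal ((norm (g x))\<^sup>2) \<partial>lborel"
  have pt: "ennreal (c\<^sup>2 * m) * indicator S x \<le> 4 * (\<integral>\<^sup>+h. ?d x h \<partial>lborel)" for x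
  proof (cases "x \<in> S")
    case True
    have "ennreal (c\<^sup>2) * ennreal m = (\<integral>\<^sup>+h. ennreal (c\<^sup>2) * indicator B h \<partial>lborel)"
      by (simp add: nn_integral_cmult_indicator eB)
    also have "\<dots> \<le> (\<integral>\<^sup>+h. 2 * ?d x h + 2 * (ennreal ((v (x + h))\<^sup>2) * indicator B h) \<partial>lborel)"
    proof (rule nn_integral_mono)
      fix h
      have "c\<^sup>2 \<le> (v x)\<^sup>2" using large[OF True] \<open>c > 0\<close>
        by (metis abs_le_square_iff abs_of_pos)
      also have "\<dots> \<le> 2 * (v (x + h) - v x)\<^sup>2 + 2 * (v (x + h))\<^sup>2"
      proof -
        \<comment> \<open>The difference of the two sides is exactly this square.\<close>
        have "0 \<le> (2 * v (x + h) - v x)\<^sup>2" by simp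
        thus ?thesis by (simp add: power2_eq_square algebra_simps)
      qed
      finally have "ennreal (c\<^sup>2) \<le> ennreal (2 * (v (x + h) - v x)\<^sup>2 + 2 * (v (x + h))\<^sup>2)"
        by (rule ennreal_leI)
      also have "\<dots> = 2 * ennreal ((v (x + h) - v x)\<^sup>2) + 2 * ennreal ((v (x + h))\<^sup>2)"
        by (simp add: ennreal_mult')
      finally show "ennreal (c\<^sup>2) * indicator B h \<le> 2 * ?d x h + 2 * (ennreal ((v (x + h))\<^sup>2) * indicator B h)"
        by (simp split: split_indicator)
    qed
    also have "\<dots> = 2 * (\<integral>\<^sup>+h. ?d x h \<partial>lborel) + 2 * (\<integral>\<^sup>+h. ennreal ((v (x + h))\<^sup>2) * indicator B h \<partial>lborel)"
      by (simp add: nn_integral_add nn_integral_cmult)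
    also have "(\<integral>\<^sup>+h. ennreal ((v (x + h))\<^sup>2) * indicator B h \<partial>lborel)
      = (\<integral>\<^sup>+y. ennreal ((v y)\<^sup>2) * indicator (ball x a) y \<partial>lborel)"
      by (subst nn_integral_lborel_translate[of "\<lambda>y. ennreal ((v y)\<^sup>2) * indicator (ball x a) y" x, symmetric], measurable)
        (auto intro!: nn_integral_cong simp: add.commute B_def dist_norm split: split_indicator)
    also have "\<dots> \<le> ennreal (c\<^sup>2 / 4) * ennreal m"
      using small[OF True] by (simp add: eB flip: B_def)
    finally have "ennreal (c\<^sup>2) * ennreal m \<le>
        2 * (\<integral>\<^sup>+h. ?d x h \<partial>lborel) + 2 * (ennreal (c\<^sup>2 / 4) * ennreal m)"
      by (meson add_left_mono mult_left_mono order_trans zero_le)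
    \<comment> \<open>The factor 1/4 in the smallness hypothesis makes this term half of the left
      side; being finite, it can be cancelled, which leaves the integral of the differences
      alone.\<close>
    also have "2 * (ennreal (c\<^sup>2 / 4) * ennreal m) = ennreal (c\<^sup>2 * m / 2)"
      using m by (simp add: ennreal_mult'[symmetric] flip: ennreal_numeral)
    finally have *: "ennreal (c\<^sup>2 * m) \<le> 2 * (\<integral>\<^sup>+h. ?d x h \<partial>lborel) + ennreal (c\<^sup>2 * m / 2)"
      by (simp add: ennreal_mult')
    have "ennreal (c\<^sup>2 * m / 2) + ennreal (c\<^sup>2 * m / 2) = ennreal (c\<^sup>2 * m)"
      using m by (subst ennreal_plus[symmetric]) auto
    with * have "ennreal (c\<^sup>2 * m / 2) + ennreal (c\<^sup>2 * m / 2) \<le> ennreal (c\<^sup>2 * m / 2) + 2 * (\<integral>\<^sup>+h. ?d x h \<partial>lborel)"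
      by (simp add: add.commute)
    hence "ennreal (c\<^sup>2 * m / 2) \<le> 2 * (\<integral>\<^sup>+h. ?d x h \<partial>lborel)"
      by (simp add: ennreal_add_left_cancel_le)
    hence "2 * ennreal (c\<^sup>2 * m / 2) \<le> 2 * (2 * (\<integral>\<^sup>+h. ?d x h \<partial>lborel))"
      by (intro mult_left_mono) auto
    moreover have "2 * ennreal (c\<^sup>2 * m / 2) = ennreal (c\<^sup>2 * m)"
      using m by (simp add: ennreal_mult'[symmetric] flip: ennreal_numeral)
    ultimately show ?thesis using True by (simp add: mult.assoc[symmetric])
  qed simp
  \<comment> \<open>Integrating \<open>pt\<close> over \<open>x\<close> and swapping the integrals
    reduces to a single shift \<open>h\<close> in \<open>B\<close>, where \<open>norm h < a\<close>.
    The volume \<open>m\<close> of \<open>B\<close> then stands on both sides and is divided out at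
    the end.\<close>
  have "ennreal m * (ennreal (c\<^sup>2) * emeasure lborel S) = (\<integral>\<^sup>+x. ennreal (c\<^sup>2 * m) * indicator S x \<partial>lborel)"
    using m by (subst nn_integral_cmult_indicator) (auto simp: ennreal_mult' mult_ac)
  also have "\<dots> \<le> (\<integral>\<^sup>+x. 4 * (\<integral>\<^sup>+h. ?d x h \<partial>lborel) \<partial>lborel)"
    by (intro nn_integral_mono pt)
  also have "\<dots> = 4 * (\<integral>\<^sup>+x. (\<integral>\<^sup>+h. ?d x h \<partial>lborel) \<partial>lborel)"
    by (rule nn_integral_cmult) measurable
  also have "(\<integral>\<^sup>+x. (\<integral>\<^sup>+h. ?d x h \<partial>lborel) \<partial>lborel) = (\<integral>\<^sup>+h. (\<integral>\<^sup>+x. ?d x h \<partial>lborel) \<partial>lborel)"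
    by (rule lborel_pair.Fubini') measurable
  also have "\<dots> \<le> (\<integral>\<^sup>+h. (ennreal (a\<^sup>2) * ?G) * indicator B h \<partial>lborel)"
  proof (rule nn_integral_mono)
    fix h
    have "(\<integral>\<^sup>+x. ?d x h \<partial>lborel) = (\<integral>\<^sup>+x. ennreal ((v (x + h) - v x)\<^sup>2) \<partial>lborel) * indicator B h"
      by (rule nn_integral_multc) measurable
    also have "\<dots> \<le> (ennreal ((norm h)\<^sup>2) * ?G) * indicator B h"
      by (intro mult_right_mono nn_integral_power2_diff_translate_le v g) auto
    also have "\<dots> \<le> (ennreal (a\<^sup>2) * ?G) * indicator B h"
      by (auto simp: B_def split: split_indicator intro!: mult_right_mono ennreal_leI power_mono)
    finally show "(\<integral>\<^sup>+x. ?d x h \<partial>lborel) \<le> (ennreal (a\<^sup>2) * ?G) * indicator B h" .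
  qed
  also have "\<dots> = (ennreal (a\<^sup>2) * ?G) * ennreal m"
    by (simp add: nn_integral_cmult_indicator eB)
  finally have "ennreal m * (ennreal (c\<^sup>2) * emeasure lborel S) \<le> 4 * ((ennreal (a\<^sup>2) * ?G) * ennreal m)"
    by (simp add: mult_left_mono)
  also have "\<dots> = ennreal m * (ennreal (4 * a\<^sup>2) * ?G)"
    by (simp add: ennreal_mult' mult_ac)
  finally show ?thesis
    using m by (subst (asm) ennreal_mult_le_mult_iff) auto
qed

subsection \<open>Sobolev inequality\<close>

text \<open>At 0 the difference quotient is at most \<open>\<bar>h\<bar>\<close> in absolute value.
  Translates of this function are the pieces of the quadratic spline used for truncation.\<close>

lemma DERIV_power2_max0:
  "((\<lambda>t::real. (max 0 t)\<^sup>2) has_real_derivative 2 * max 0 t) (at t)"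
proof (cases t "0::real" rule: linorder_cases)
  case less
  have "((\<lambda>t::real. 0) has_real_derivative 2 * max 0 t) (at t)"
    using less by (auto intro!: derivative_eq_intros)
  thus ?thesis
    by (rule has_field_derivative_transform_within_open[of _ _ _ "{..<0}"]) (use less in auto)
next
  case greater
  have "((\<lambda>t::real. t\<^sup>2) has_real_derivative 2 * max 0 t) (at t)"
    using greater by (auto intro!: derivative_eq_intros)
  thus ?thesis
    by (rule has_field_derivative_transform_within_open[of _ _ _ "{0<..}"]) (use greater in auto)
next
  case equal
  have "((\<lambda>h::real. (max 0 h)\<^sup>2 / h) \<longlongrightarrow> 0) (at 0)"
  proof (rule Lim_null_comparison[where g = "\<lambda>h. \<bar>h\<bar>"])
    show "\<forall>\<^sub>F h::real in at 0. norm ((max 0 h)\<^sup>2 / h) \<le> \<bar>h\<bar>"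
      by (auto simp: max_def power2_eq_square)
    show "((\<lambda>h::real. \<bar>h\<bar>) \<longlongrightarrow> 0) (at 0)"
      by (rule tendsto_rabs_zero) (rule tendsto_ident_at)
  qed
  thus ?thesis using equal by (simp add: DERIV_def)
qed

text \<open>With a \<open>C^1\<close> truncation the classical chain rule applies to its composition
  with a test function. The derivative lives on the layer between \<open>l\<close> and
  \<open>2 * l\<close>, so that gradients belonging to different dyadic levels do not overlap, and
  its bound is independent of \<open>l\<close>.\<close>

lemma C1_truncation:
  fixes l :: real
  assumes "l > 0"
  obtains T T' :: "real \<Rightarrow> real"
  where "\<And>s. (T has_real_derivative T' s) (at s)" "continuous_on UNIV T'"
    "\<And>s. \<bar>s\<bar> \<le> l \<Longrightarrow> T s = 0" "\<And>s. 2 * l \<le> \<bar>s\<bar> \<Longrightarrow> T s = l" "\<And>s. \<bar>T s\<bar> \<le> l"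
    "\<And>s. \<bar>T' s\<bar> \<le> 3 * indicator {s. l < \<bar>s\<bar> \<and> \<bar>s\<bar> < 2 * l} s"
proof
  \<comment> \<open>A quadratic spline: \<open>\<theta>'\<close> is the tent function on \<open>[0, 1]\<close> with height \<open>2\<close>.\<close>
  define \<theta> :: "real \<Rightarrow> real" where
    "\<theta> t = 2 * (max 0 t)\<^sup>2 - 4 * (max 0 (t - 1/2))\<^sup>2 + 2 * (max 0 (t - 1))\<^sup>2" for t
  define \<theta>' :: "real \<Rightarrow> real" where
    "\<theta>' t = 4 * max 0 t - 8 * max 0 (t - 1/2) + 4 * max 0 (t - 1)" for t
  \<comment> \<open>Affine in \<open>s\<^sup>2\<close>, hence even and yet differentiable at 0;
    normalized to be 0 at \<open>\<bar>s\<bar> = l\<close> and 1 at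
    \<open>\<bar>s\<bar> = 2 * l\<close>.\<close>
  define w where "w s = (s\<^sup>2 - l\<^sup>2) / (3 * l\<^sup>2)" for s
  define T where "T s = l * \<theta> (w s)" for s
  define T' where "T' s = l * (\<theta>' (w s) * (2 * s / (3 * l\<^sup>2)))" for s
  have \<theta>: "(\<theta> has_real_derivative \<theta>' t) (at t)" for t
  proof -
    have a: "((\<lambda>t. (max 0 (t - c))\<^sup>2) has_real_derivative 2 * max 0 (t - c)) (at t)" for c
      by (rule DERIV_cong, rule DERIV_chain2[where f = "\<lambda>t. (max 0 t)\<^sup>2" and g = "\<lambda>t. t - c"])
        (rule DERIV_power2_max0, auto intro!: derivative_eq_intros)
    show ?thesis unfolding \<theta>_def \<theta>'_def
      by (rule DERIV_cong, (rule DERIV_add DERIV_diff DERIV_cmult a DERIV_power2_max0)+) simp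
  qed
  have w: "(w has_real_derivative 2 * s / (3 * l\<^sup>2)) (at s)" for s
    unfolding w_def using assms by (auto intro!: derivative_eq_intros simp: field_simps power4_eq_xxxx power2_eq_square)
  show "(T has_real_derivative T' s) (at s)" for s
    unfolding T_def T'_def by (rule DERIV_cmult DERIV_chain2 \<theta> w)+
  show "continuous_on UNIV T'"
    unfolding T'_def \<theta>'_def w_def using assms by (auto intro!: continuous_intros)
  have sq: "0 < l\<^sup>2" using assms by simp
  have w0: "w s \<le> 0" if "\<bar>s\<bar> \<le> l" for s
    using that sq assms abs_le_square_iff[of s l] by (auto simp: w_def divide_le_0_iff)
  have w1: "1 \<le> w s" if "2 * l \<le> \<bar>s\<bar>" for s
  proof -
    have "(2 * l)\<^sup>2 \<le> s\<^sup>2" using that assms abs_le_square_iff[of "2 * l" s] by simp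
    thus ?thesis using sq by (simp add: w_def le_divide_eq)
  qed
  have \<theta>0: "\<theta> t = 0" if "t \<le> 0" for t using that by (simp add: \<theta>_def max_def)
  have \<theta>1: "\<theta> t = 1" if "t \<ge> 1" for t
    using that by (simp add: \<theta>_def max_def power2_eq_square algebra_simps)
  show "T s = 0" if "\<bar>s\<bar> \<le> l" for s using \<theta>0[OF w0[OF that]] by (simp add: T_def)
  show "T s = l" if "2 * l \<le> \<bar>s\<bar>" for s using \<theta>1[OF w1[OF that]] by (simp add: T_def)
  have \<theta>b: "0 \<le> \<theta> t \<and> \<theta> t \<le> 1" for t
  proof -
    consider "t \<le> 0" | "0 \<le> t \<and> t \<le> 1/2" | "1/2 \<le> t \<and> t \<le> 1" | "1 \<le> t" by linarith
    thus ?thesis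
    proof cases
      case 2
      hence "\<theta> t = 2 * t\<^sup>2" by (simp add: \<theta>_def max_def)
      moreover have "t\<^sup>2 \<le> (1/2)\<^sup>2" using 2 by (intro power_mono) auto
      ultimately show ?thesis by (simp add: power2_eq_square)
    next
      case 3
      hence "\<theta> t = 1 - 2 * (1 - t)\<^sup>2"
        by (auto simp: \<theta>_def max_def power2_eq_square algebra_simps)
      moreover have "(1 - t)\<^sup>2 \<le> (1/2)\<^sup>2" using 3 by (intro power_mono) auto
      ultimately show ?thesis by (simp add: power2_eq_square)
    qed (simp_all add: \<theta>0 \<theta>1)
  qed
  show "\<bar>T s\<bar> \<le> l" for s
    using \<theta>b[of "w s"] assms by (simp add: T_def abs_mult mult_left_le)
  show "\<bar>T' s\<bar> \<le> 3 * indicator {s. l < \<bar>s\<bar> \<and> \<bar>s\<bar> < 2 * l} s" for s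
  proof (cases "l < \<bar>s\<bar> \<and> \<bar>s\<bar> < 2 * l")
    case True
    \<comment> \<open>The tent is at most 2 and \<open>\<bar>s\<bar> < 2 * l\<close>; this gives
      8/3, rounded up to 3.\<close>
    have "\<bar>\<theta>' (w s)\<bar> \<le> 2" by (auto simp: \<theta>'_def max_def abs_if)
    hence "l * (\<bar>\<theta>' (w s)\<bar> * (2 * \<bar>s\<bar> / (3 * l\<^sup>2))) \<le> l * (2 * (2 * \<bar>s\<bar> / (3 * l\<^sup>2)))"
      using assms by (intro mult_left_mono mult_right_mono) auto
    moreover have "\<bar>T' s\<bar> = l * (\<bar>\<theta>' (w s)\<bar> * (2 * \<bar>s\<bar> / (3 * l\<^sup>2)))"
      using assms by (simp add: T'_def abs_mult)
    ultimately have "\<bar>T' s\<bar> \<le> l * (2 * (2 * \<bar>s\<bar> / (3 * l\<^sup>2)))" by simp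
    also have "\<dots> \<le> l * (2 * (2 * (2 * l) / (3 * l\<^sup>2)))"
      using True assms by (intro mult_left_mono divide_right_mono) auto
    also have "\<dots> \<le> 3" using assms by (simp add: power2_eq_square)
    finally show ?thesis using True by simp
  next
    case False
    hence "w s \<le> 0 \<or> 1 \<le> w s" using w0[of s] w1[of s] by linarith
    hence "T' s = 0" by (auto simp: T'_def \<theta>'_def max_def)
    thus ?thesis by (simp add: False)
  qed
qed

section \<open>Test functions: derivatives, compact support, integrability\<close>

text \<open>Linearity recovers the derivative from its values on the coordinate vectors.\<close>

lemma test_function_has_derivative:
  assumes "\<phi> \<in> test_functions"
  shows "(\<phi> has_derivative (\<lambda>h. grad \<phi> x \<bullet> h)) (at x)"
proof -
  have "Ck (Suc 0) \<phi>" using assms by (auto simp: test_functions_def simp del: Ck.simps)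
  hence "\<phi> differentiable (at x)" by simp
  hence D: "(\<phi> has_derivative frechet_derivative \<phi> (at x)) (at x)"
    by (simp add: frechet_derivative_works)
  then interpret linear "frechet_derivative \<phi> (at x)" by (rule has_derivative_linear)
  have "frechet_derivative \<phi> (at x) = (\<lambda>h. grad \<phi> x \<bullet> h)"
  proof
    fix h
    have "frechet_derivative \<phi> (at x) h = frechet_derivative \<phi> (at x) (\<Sum>i\<in>UNIV. h $ i *\<^sub>R axis i 1)"
      using basis_expansion[of h] by (simp add: scalar_mult_eq_scaleR)
    also have "\<dots> = grad \<phi> x \<bullet> h"
      by (simp add: sum scale inner_vec_def grad_def partial_def mult.commute)
    finally show "frechet_derivative \<phi> (at x) h = grad \<phi> x \<bullet> h" .
  qed
  with D show ?thesis by simp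
qed

lemma continuous_on_test_function:
  assumes "\<phi> \<in> test_functions"
  shows "continuous_on S \<phi>"
  using test_function_has_derivative[OF assms]
  by (auto intro!: continuous_at_imp_continuous_on has_derivative_continuous)

lemma continuous_on_grad:
  assumes "\<phi> \<in> test_functions"
  shows "continuous_on S (grad \<phi>)"
proof -
  have "Ck (Suc 0) \<phi>" using assms by (auto simp: test_functions_def simp del: Ck.simps)
  hence "continuous_on S (partial i \<phi>)" for i
    by (auto intro: continuous_on_subset)
  thus ?thesis unfolding grad_def by (intro continuous_on_vec_lambda)
qed

text \<open>The complement of the support is open and the function is constant there, so uniqueness
  of the derivative applies.\<close>

lemma grad_eq_0_outside_support:
  assumes "\<phi> \<in> test_functions" "x \<notin> closure {x. \<phi> x \<noteq> 0}"
  shows "grad \<phi> x = 0"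
proof -
  have "((\<lambda>_. 0) has_derivative (\<lambda>h. grad \<phi> x \<bullet> h)) (at x)"
    by (rule has_derivative_transform_within_open[OF test_function_has_derivative[OF assms(1)],
          where s = "- closure {x. \<phi> x \<noteq> 0}"])
      (use assms(2) closure_subset[of "{x. \<phi> x \<noteq> 0}"] in auto)
  from has_derivative_unique[OF this has_derivative_const]
  have "grad \<phi> x \<bullet> grad \<phi> x = 0" by (rule fun_cong)
  thus ?thesis by simp
qed

lemma nn_integral_compact_support_finite:
  fixes f :: "'a::euclidean_space \<Rightarrow> real"
  assumes "continuous_on K f" "compact K" "\<And>x. x \<notin> K \<Longrightarrow> f x = 0"
  shows "(\<integral>\<^sup>+x. ennreal (f x) \<partial>lborel) < \<infinity>"
proof -
  have "bounded (f ` K)" using assms by (intro compact_imp_bounded compact_continuous_image)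
  then obtain M where M: "\<And>x. x \<in> K \<Longrightarrow> \<bar>f x\<bar> \<le> M" by (auto simp: bounded_iff)
  have "(\<integral>\<^sup>+x. ennreal (f x) \<partial>lborel) \<le> (\<integral>\<^sup>+x. ennreal M * indicator K x \<partial>lborel)"
    using M assms(3) by (intro nn_integral_mono) (force split: split_indicator intro: ennreal_leI)
  also have "\<dots> = ennreal M * emeasure lborel K"
    using assms by (intro nn_integral_cmult_indicator) (auto simp: compact_imp_closed borel_closed)
  also have "\<dots> < \<infinity>"
    using emeasure_bounded_finite[OF compact_imp_bounded[OF \<open>compact K\<close>]]
    by (simp add: ennreal_mult_less_top)
  finally show ?thesis .
qed

lemma test_function_power_integrable:
  assumes "\<phi> \<in> test_functions" "p > 0"
  shows "(\<integral>\<^sup>+x. ennreal (\<bar>\<phi> x\<bar> powr p) \<partial>lborel) < \<infinity>"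
proof (rule nn_integral_compact_support_finite[of "closure {x. \<phi> x \<noteq> 0}"])
  show "continuous_on (closure {x. \<phi> x \<noteq> 0}) (\<lambda>x. \<bar>\<phi> x\<bar> powr p)"
    using \<open>p > 0\<close> by (intro continuous_on_powr' continuous_intros continuous_on_test_function assms) auto
  show "compact (closure {x. \<phi> x \<noteq> 0})" using assms by (simp add: test_functions_def)
qed (use closure_subset[of "{x. \<phi> x \<noteq> 0}"] in auto)

lemma test_function_grad_integrable:
  assumes "\<phi> \<in> test_functions"
  shows "(\<integral>\<^sup>+x. ennreal ((norm (grad \<phi> x))\<^sup>2) \<partial>lborel) < \<infinity>"
proof (rule nn_integral_compact_support_finite[of "closure {x. \<phi> x \<noteq> 0}"])
  show "continuous_on (closure {x. \<phi> x \<noteq> 0}) (\<lambda>x. (norm (grad \<phi> x))\<^sup>2)"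
    by (intro continuous_intros continuous_on_grad assms)
  show "compact (closure {x. \<phi> x \<noteq> 0})" using assms by (simp add: test_functions_def)
qed (simp add: grad_eq_0_outside_support[OF assms])

lemma test_function_bounded:
  assumes "\<phi> \<in> test_functions"
  obtains M where "M > 0" "\<And>x. \<bar>\<phi> x\<bar> \<le> M"
proof -
  have "compact (closure {x. \<phi> x \<noteq> 0})" using assms by (simp add: test_functions_def)
  hence "bounded (\<phi> ` closure {x. \<phi> x \<noteq> 0})"
    by (intro compact_imp_bounded compact_continuous_image continuous_on_test_function assms)
  then obtain M where M: "M > 0" "\<And>x. x \<in> closure {x. \<phi> x \<noteq> 0} \<Longrightarrow> \<bar>\<phi> x\<bar> \<le> M"
    by (auto simp: bounded_pos)
  show ?thesis
  proof (rule that[OF M(1)])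
    fix x show "\<bar>\<phi> x\<bar> \<le> M"
      using M closure_subset[of "{x. \<phi> x \<noteq> 0}"] by (cases "\<phi> x = 0") auto
  qed
qed

section \<open>Dyadic levels and the Sobolev inequality\<close>

text \<open>Chebyshev's inequality for the power \<open>p\<close>.\<close>

lemma superlevel_powr_le:
  fixes f :: "'a \<Rightarrow> real"
  assumes [measurable]: "f \<in> borel_measurable M" and "l > 0" "p > 0"
  shows "emeasure M {x \<in> space M. l \<le> \<bar>f x\<bar>} \<le> ennreal (l powr - p) * (\<integral>\<^sup>+x. ennreal (\<bar>f x\<bar> powr p) \<partial>M)"
proof -
  have "{x \<in> space M. l \<le> \<bar>f x\<bar>} \<subseteq>
      {x \<in> space M. 1 \<le> ennreal (l powr - p) * ennreal (\<bar>f x\<bar> powr p)}"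
  proof clarify
    fix x assume "l \<le> \<bar>f x\<bar>"
    hence "l powr p \<le> \<bar>f x\<bar> powr p" using \<open>l > 0\<close> \<open>p > 0\<close> by (intro powr_mono2) auto
    hence "1 \<le> l powr - p * \<bar>f x\<bar> powr p"
      using \<open>l > 0\<close> by (simp add: powr_minus field_simps)
    thus "1 \<le> ennreal (l powr - p) * ennreal (\<bar>f x\<bar> powr p)"
      by (simp add: ennreal_mult'[symmetric])
  qed
  hence "emeasure M {x \<in> space M. l \<le> \<bar>f x\<bar>} \<le>
      emeasure M {x \<in> space M. 1 \<le> ennreal (l powr - p) * ennreal (\<bar>f x\<bar> powr p)}"
    by (intro emeasure_mono) measurable
  also have "\<dots> \<le> ennreal (l powr - p) * (\<integral>\<^sup>+x. ennreal (\<bar>f x\<bar> powr p) * indicator (space M) x \<partial>M)"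
    by (rule nn_integral_Markov_inequality) auto
  also have "(\<integral>\<^sup>+x. ennreal (\<bar>f x\<bar> powr p) * indicator (space M) x \<partial>M) = (\<integral>\<^sup>+x. ennreal (\<bar>f x\<bar> powr p) \<partial>M)"
    by (intro nn_integral_cong) auto
  finally show ?thesis .
qed

text \<open>\<open>superlevel_measure_le\<close> is applied to a truncation of \<open>\<phi>\<close>
  at height \<open>l\<close>, which the truncation attains where
  \<open>2 * l \<le> \<bar>\<phi> x\<bar>\<close>. The gradient is integrated over one layer only,
  so that summing over dyadic levels costs at most the full gradient integral.\<close>

lemma truncated_superlevel_le:
  fixes \<phi> :: "real ^ 'n::finite \<Rightarrow> real"
  defines "N \<equiv> real CARD('n)" and "p \<equiv> crit_exp CARD('n)"
  assumes "CARD('n) \<ge> 3" and \<phi>: "\<phi> \<in> test_functions" and "l > 0" and "P > 0"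
    and P: "(\<integral>\<^sup>+x. ennreal (\<bar>\<phi> x\<bar> powr p) \<partial>lborel) \<le> ennreal P"
  shows "ennreal (l powr p) * emeasure lborel {x. 2 * l \<le> \<bar>\<phi> x\<bar>} \<le>
    ennreal (36 * (4 / unit_ball_vol N) powr (2 / N) * P powr (2 / N)) *
    (\<integral>\<^sup>+x. ennreal ((norm (grad \<phi> x))\<^sup>2) * indicator {x. l < \<bar>\<phi> x\<bar> \<and> \<bar>\<phi> x\<bar> < 2 * l} x \<partial>lborel)"
proof -
  define \<omega> where "\<omega> = unit_ball_vol N"
  have N: "N \<ge> 3" using assms by (simp add: N_def)
  have \<omega>: "\<omega> > 0" using N by (simp add: \<omega>_def)
  \<comment> \<open>The second identity is where the critical exponent enters: it makes the powers
    of \<open>l\<close> balance when \<open>a\<^sup>2\<close> is written out below.\<close>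
  have p: "p > 2" "p * (2 / N) = p - 2"
    using N by (simp_all add: p_def crit_exp_def N_def[symmetric] field_simps)
  obtain T T' :: "real \<Rightarrow> real" where
    T: "\<And>s. (T has_real_derivative T' s) (at s)" "continuous_on UNIV T'"
    "\<And>s. \<bar>s\<bar> \<le> l \<Longrightarrow> T s = 0" "\<And>s. 2 * l \<le> \<bar>s\<bar> \<Longrightarrow> T s = l" "\<And>s. \<bar>T s\<bar> \<le> l"
    "\<And>s. \<bar>T' s\<bar> \<le> 3 * indicator {s. l < \<bar>s\<bar> \<and> \<bar>s\<bar> < 2 * l} s"
    using C1_truncation[OF \<open>l > 0\<close>] by blast
  have [measurable]: "\<phi> \<in> borel_measurable borel" "grad \<phi> \<in> borel_measurable borel"
    using \<phi> by (auto intro!: borel_measurable_continuous_onI continuous_on_test_function continuous_on_grad)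
  define S where "S = {x. 2 * l \<le> \<bar>\<phi> x\<bar>}"
  have [measurable]: "S \<in> sets borel" unfolding S_def by measurable
  \<comment> \<open>The radius is chosen so that the ball of radius \<open>a\<close> has volume \<open>4 P / l\<^sup>p\<close>, four times the
    Chebyshev bound for the set where the truncation does not vanish.\<close>
  define b where "b = 4 * P / (\<omega> * l powr p)"
  have b: "b > 0" using \<open>l > 0\<close> \<open>P > 0\<close> \<omega> by (simp add: b_def)
  define a where "a = b powr (1 / N)"
  have a: "a > 0" using b by (simp add: a_def)
  have "a ^ CARD('n) = a powr N" using a by (simp add: N_def powr_realpow)
  also have "\<dots> = b" using b N by (simp add: a_def powr_powr)
  finally have vol: "emeasure lborel (ball (0::real^'n) a) = ennreal (4 * P / l powr p)"
    using a \<omega> by (simp add: emeasure_ball \<omega>_def[symmetric] N_def[symmetric] b_def)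
  let ?I = "\<lambda>x. indicator {x. l < \<bar>\<phi> x\<bar> \<and> \<bar>\<phi> x\<bar> < 2 * l} x"
  have "ennreal (l\<^sup>2) * emeasure lborel S \<le>
    ennreal (4 * a\<^sup>2) * (\<integral>\<^sup>+x. ennreal ((norm (T' (\<phi> x) *\<^sub>R grad \<phi> x))\<^sup>2) \<partial>lborel)"
  proof (rule superlevel_measure_le[where v = "\<lambda>x. T (\<phi> x)"])
    fix x
    show "((\<lambda>x. T (\<phi> x)) has_derivative (\<lambda>h. (T' (\<phi> x) *\<^sub>R grad \<phi> x) \<bullet> h)) (at x)"
      using has_derivative_compose[OF test_function_has_derivative[OF \<phi>]
          T(1)[unfolded has_field_derivative_def]]
      by simp
  next
    show "continuous_on UNIV (\<lambda>x. T' (\<phi> x) *\<^sub>R grad \<phi> x)"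
      by (intro continuous_intros continuous_on_grad continuous_on_compose2[OF T(2)]
          continuous_on_test_function \<phi>) auto
  next
    fix x :: "real ^ 'n"
    have "(\<integral>\<^sup>+y. ennreal ((T (\<phi> y))\<^sup>2) * indicator (ball x a) y \<partial>lborel) \<le>
        (\<integral>\<^sup>+y. ennreal (l\<^sup>2) * indicator {y \<in> space lborel. l \<le> \<bar>\<phi> y\<bar>} y \<partial>lborel)"
    proof (rule nn_integral_mono)
      fix y
      have "(T (\<phi> y))\<^sup>2 \<le> l\<^sup>2" using T(5)[of "\<phi> y"] \<open>l > 0\<close> abs_le_square_iff[of "T (\<phi> y)" l]
        by simp
      thus "ennreal ((T (\<phi> y))\<^sup>2) * indicator (ball x a) y \<le>
          ennreal (l\<^sup>2) * indicator {y \<in> space lborel. l \<le> \<bar>\<phi> y\<bar>} y"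
        using T(3)[of "\<phi> y"] by (auto split: split_indicator intro: ennreal_leI)
    qed
    also have "\<dots> = ennreal (l\<^sup>2) * emeasure lborel {y \<in> space lborel. l \<le> \<bar>\<phi> y\<bar>}"
      by (rule nn_integral_cmult_indicator) measurable
    also have "\<dots> \<le> ennreal (l\<^sup>2) * (ennreal (l powr - p) * ennreal P)"
      using p(1) \<open>l > 0\<close> P
      by (intro mult_left_mono order_trans[OF superlevel_powr_le[of \<phi> lborel l p]]) auto
    also have "\<dots> = ennreal (l\<^sup>2 / 4) * ennreal (4 * P / l powr p)"
      using \<open>P > 0\<close> by (simp add: ennreal_mult'[symmetric] powr_minus field_simps)
    finally show "(\<integral>\<^sup>+y. ennreal ((T (\<phi> y))\<^sup>2) * indicator (ball x a) y \<partial>lborel)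
        \<le> ennreal (l\<^sup>2 / 4) * emeasure lborel (ball (0::real^'n) a)"
      by (simp add: vol)
  qed (use a \<open>l > 0\<close> T(4) in \<open>auto simp: S_def\<close>)
  also have "(\<integral>\<^sup>+x. ennreal ((norm (T' (\<phi> x) *\<^sub>R grad \<phi> x))\<^sup>2) \<partial>lborel) \<le>
      (\<integral>\<^sup>+x. 9 * (ennreal ((norm (grad \<phi> x))\<^sup>2) * ?I x) \<partial>lborel)"
  proof (rule nn_integral_mono)
    fix x
    have "(T' (\<phi> x))\<^sup>2 \<le> 9 * ?I x"
    proof -
      have "\<bar>T' (\<phi> x)\<bar>\<^sup>2 \<le> (3 * ?I x)\<^sup>2"
        using T(6)[of "\<phi> x"] by (intro power_mono) (auto simp: indicator_def)
      thus ?thesis by (auto split: split_indicator)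
    qed
    hence "ennreal ((norm (T' (\<phi> x) *\<^sub>R grad \<phi> x))\<^sup>2) \<le> ennreal (9 * ?I x * (norm (grad \<phi> x))\<^sup>2)"
      by (intro ennreal_leI) (simp add: power_mult_distrib mult_right_mono)
    also have "\<dots> = 9 * (ennreal ((norm (grad \<phi> x))\<^sup>2) * ?I x)"
      by (auto simp: ennreal_mult' split: split_indicator)
    finally show "ennreal ((norm (T' (\<phi> x) *\<^sub>R grad \<phi> x))\<^sup>2) \<le> 9 * (ennreal ((norm (grad \<phi> x))\<^sup>2) * ?I x)" .
  qed
  also have "\<dots> = 9 * (\<integral>\<^sup>+x. ennreal ((norm (grad \<phi> x))\<^sup>2) * ?I x \<partial>lborel)"
    by (rule nn_integral_cmult) measurable
  finally have "ennreal (l\<^sup>2) * emeasure lborel S \<le> ennreal (4 * a\<^sup>2) *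
      (9 * (\<integral>\<^sup>+x. ennreal ((norm (grad \<phi> x))\<^sup>2) * ?I x \<partial>lborel))"
    by (simp add: mult_left_mono)
  \<comment> \<open>The factor \<open>l powr (p - 2)\<close> completes \<open>l\<^sup>2\<close> to
    \<open>l powr p\<close> and cancels the power of \<open>l\<close> in \<open>a\<^sup>2\<close>.
    The constant 36 is 4 from the superlevel estimate times 9, the square of the bound on
    \<open>T'\<close>.\<close>
  hence "ennreal (l powr (p - 2)) * (ennreal (l\<^sup>2) * emeasure lborel S) \<le> ennreal (l powr (p - 2)) *
    (ennreal (4 * a\<^sup>2) * (9 * (\<integral>\<^sup>+x. ennreal ((norm (grad \<phi> x))\<^sup>2) * ?I x \<partial>lborel)))"
    by (rule mult_left_mono) simp
  also have "\<dots> = ennreal (l powr (p - 2) * (4 * a\<^sup>2) * 9) *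
      (\<integral>\<^sup>+x. ennreal ((norm (grad \<phi> x))\<^sup>2) * ?I x \<partial>lborel)"
    by (simp add: ennreal_mult' mult_ac)
  also have "l powr (p - 2) * (4 * a\<^sup>2) * 9 = 36 * (4 / \<omega>) powr (2 / N) * P powr (2 / N)"
  proof -
    have "a\<^sup>2 = b powr (2 / N)"
      using b by (simp add: a_def power2_eq_square powr_add[symmetric])
    also have "\<dots> = (4 / \<omega>) powr (2 / N) * P powr (2 / N) / (l powr p) powr (2 / N)"
      using \<omega> \<open>P > 0\<close> \<open>l > 0\<close> by (simp add: b_def powr_divide[symmetric] powr_mult[symmetric])
    also have "(l powr p) powr (2 / N) = l powr (p - 2)"
      by (simp only: powr_powr p(2))
    finally show ?thesis using \<open>l > 0\<close> by simp
  qed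
  also have "ennreal (l powr (p - 2)) * (ennreal (l\<^sup>2) * emeasure lborel S) = ennreal (l powr p) * emeasure lborel S"
  proof -
    have "l powr (p - 2) * l\<^sup>2 = l powr p"
      using \<open>l > 0\<close> by (simp add: powr_diff)
    thus ?thesis by (simp add: mult.assoc[symmetric] flip: ennreal_mult')
  qed
  finally show ?thesis by (simp add: S_def \<omega>_def)
qed

text \<open>Let \<open>N\<close> be the dimension and \<open>P\<close> the integral of the critical
  power. Summing the estimate at one level over dyadic levels bounds \<open>P\<close> by a multiple
  of \<open>K * P powr (2 / N)\<close>, and the smaller power of \<open>P\<close> is absorbed. The
  exponent \<open>N / (N - 2)\<close> is half the critical one.\<close>

lemma sobolev_inequality:
  assumes "CARD('n::finite) \<ge> 3"
  shows "\<exists>C>0. \<forall>\<phi> \<in> test_functions. \<forall>K\<ge>0.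
    (\<integral>\<^sup>+x. ennreal ((norm (grad \<phi> x))\<^sup>2) \<partial>lborel) \<le> ennreal K \<longrightarrow>
    (\<integral>\<^sup>+x. ennreal (\<bar>\<phi> (x :: real ^ 'n)\<bar> powr crit_exp CARD('n)) \<partial>lborel)
      \<le> ennreal ((C * K) powr (real CARD('n) / (real CARD('n) - 2)))"
proof -
  define N where "N = real CARD('n)"
  define p where "p = crit_exp CARD('n)"
  \<comment> \<open>\<open>4 powr p\<close> pays for comparing \<open>\<bar>\<phi> x\<bar>\<close>
    with a dyadic level; the other factor comes from \<open>truncated_superlevel_le\<close>.\<close>
  define C where "C = 4 powr p * (36 * (4 / unit_ball_vol N) powr (2 / N))"
  have N: "N \<ge> 3" using assms by (simp add: N_def)
  have p: "p > 2"
    using N by (simp add: p_def crit_exp_def N_def[symmetric] field_simps)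
  have "unit_ball_vol N > 0" using N by simp
  hence C: "C > 0" by (simp add: C_def)
  show ?thesis unfolding N_def[symmetric] p_def[symmetric]
  proof (intro exI[of _ C] conjI C ballI allI impI)
    fix \<phi> :: "real ^ 'n \<Rightarrow> real" and K :: real
    assume \<phi>: "\<phi> \<in> test_functions" and "K \<ge> 0"
      and K: "(\<integral>\<^sup>+x. ennreal ((norm (grad \<phi> x))\<^sup>2) \<partial>lborel) \<le> ennreal K"
    have [measurable]: "\<phi> \<in> borel_measurable borel" "grad \<phi> \<in> borel_measurable borel"
      using \<phi> by (auto intro!: borel_measurable_continuous_onI continuous_on_test_function continuous_on_grad)
    \<comment> \<open>Compact support makes the integral finite; this justifies the later division
      by \<open>P powr (2 / N)\<close>.\<close>
    obtain P where P: "P \<ge> 0" "(\<integral>\<^sup>+x. ennreal (\<bar>\<phi> x\<bar> powr p) \<partial>lborel) = ennreal P"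
      using test_function_power_integrable[OF \<phi>, of p] p
      by (cases "\<integral>\<^sup>+x. ennreal (\<bar>\<phi> x\<bar> powr p) \<partial>lborel" rule: ennreal_cases) auto
    obtain M where M: "M > 0" "\<And>x. \<bar>\<phi> x\<bar> \<le> M" using test_function_bounded[OF \<phi>] by blast
    have "P \<le> (C * K) powr (N / (N - 2))"
    proof (cases "P = 0")
      case False
      with P have "P > 0" by simp
      \<comment> \<open>The levels descend from the bound \<open>M\<close> to 0, so natural indices
        reach every nonzero value of \<open>\<phi>\<close>.\<close>
      define l where "l k = M / 2 ^ k" for k :: nat
      have l: "l k > 0" for k using M by (simp add: l_def)
      define A where "A k = {x. l k < \<bar>\<phi> x\<bar> \<and> \<bar>\<phi> x\<bar> < 2 * l k}" for k
      let ?c = "36 * (4 / unit_ball_vol N) powr (2 / N) * P powr (2 / N)"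
      have [measurable]: "A k \<in> sets borel" for k unfolding A_def by measurable
      have disj: "disjoint_family A"
      proof -
        have "A j \<inter> A k = {}" if "j < k" for j k
        proof -
          have "2 * l k \<le> l j"
          proof -
            have "(2::real) ^ Suc j \<le> 2 ^ k" using that by (intro power_increasing) auto
            thus ?thesis using M by (simp add: l_def field_simps)
          qed
          thus ?thesis by (auto simp: A_def)
        qed
        thus ?thesis
          unfolding disjoint_family_on_def by (metis Int_commute linorder_neqE_nat)
      qed
      \<comment> \<open>A single term of the series suffices: for the least \<open>k\<close> with
        \<open>2 * l k \<le> \<bar>\<phi> x\<bar>\<close>, minimality (or the bound
        \<open>M\<close>, if \<open>k = 0\<close>) gives
        \<open>\<bar>\<phi> x\<bar> \<le> 4 * l k\<close>.\<close>
      have pt: "ennreal (\<bar>\<phi> x\<bar> powr p) \<le>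
          (\<Sum>k. ennreal (4 powr p * l k powr p) * indicator {x. 2 * l k \<le> \<bar>\<phi> x\<bar>} x)" for x
      proof (cases "\<phi> x = 0")
        case False
        have "(\<lambda>k. 2 * M * (1 / 2) ^ k) \<longlonglongrightarrow> 2 * M * 0"
          by (intro tendsto_intros LIMSEQ_realpow_zero) auto
        hence "\<forall>\<^sub>F k in sequentially. 2 * M * (1 / 2) ^ k < \<bar>\<phi> x\<bar>"
          using False by (intro order_tendstoD) auto
        then obtain k0 where k0: "2 * l k0 \<le> \<bar>\<phi> x\<bar>"
          by (force simp: eventually_sequentially l_def power_divide dest: less_imp_le)
        define k where "k = (LEAST k. 2 * l k \<le> \<bar>\<phi> x\<bar>)"
        have k: "2 * l k \<le> \<bar>\<phi> x\<bar>" unfolding k_def using k0 by (rule LeastI)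
        have "\<bar>\<phi> x\<bar> \<le> 4 * l k"
        proof (cases k)
          case 0
          thus ?thesis using M(1) M(2)[of x] by (simp add: l_def)
        next
          case (Suc j)
          hence "\<not> 2 * l j \<le> \<bar>\<phi> x\<bar>" unfolding k_def by (intro not_less_Least) auto
          thus ?thesis using Suc by (simp add: l_def)
        qed
        hence "\<bar>\<phi> x\<bar> powr p \<le> (4 * l k) powr p" using p by (intro powr_mono2) auto
        hence "ennreal (\<bar>\<phi> x\<bar> powr p) \<le> ennreal (4 powr p * l k powr p) * indicator {x. 2 * l k \<le> \<bar>\<phi> x\<bar>} x"
          using k l[of k] by (auto simp: powr_mult intro: ennreal_leI)
        also have "\<dots> \<le> (\<Sum>k. ennreal (4 powr p * l k powr p) * indicator {x. 2 * l k \<le> \<bar>\<phi> x\<bar>} x)"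
        proof -
          have "F k \<le> (\<Sum>k. F k)" for F :: "nat \<Rightarrow> ennreal"
            using sum_le_suminf[of F "{k}"] by simp
          thus ?thesis .
        qed
        finally show ?thesis .
      qed simp
      have "ennreal P = (\<integral>\<^sup>+x. ennreal (\<bar>\<phi> x\<bar> powr p) \<partial>lborel)" by (simp add: P)
      also have "\<dots> \<le> (\<integral>\<^sup>+x. (\<Sum>k. ennreal (4 powr p * l k powr p) * indicator {x. 2 * l k \<le> \<bar>\<phi> x\<bar>} x) \<partial>lborel)"
        by (intro nn_integral_mono pt)
      also have "\<dots> = (\<Sum>k. (\<integral>\<^sup>+x. ennreal (4 powr p * l k powr p) * indicator {x. 2 * l k \<le> \<bar>\<phi> x\<bar>} x \<partial>lborel))"
        by (rule nn_integral_suminf) measurable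
      also have "\<dots> = (\<Sum>k. ennreal (4 powr p) * (ennreal (l k powr p) * emeasure lborel {x. 2 * l k \<le> \<bar>\<phi> x\<bar>}))"
        by (subst nn_integral_cmult_indicator) (auto simp: ennreal_mult' mult.assoc)
      also have "\<dots> \<le> (\<Sum>k. ennreal (4 powr p) * (ennreal ?c *
          (\<integral>\<^sup>+x. ennreal ((norm (grad \<phi> x))\<^sup>2) * indicator (A k) x \<partial>lborel)))"
        unfolding A_def N_def p_def
        by (intro suminf_le mult_left_mono truncated_superlevel_le assms \<phi> l \<open>P > 0\<close>)
          (auto simp: P p_def[symmetric])
      also have "\<dots> = ennreal (4 powr p) * (ennreal ?c *
          (\<Sum>k. \<integral>\<^sup>+x. ennreal ((norm (grad \<phi> x))\<^sup>2) * indicator (A k) x \<partial>lborel))"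
        by simp
      also have "(\<Sum>k. \<integral>\<^sup>+x. ennreal ((norm (grad \<phi> x))\<^sup>2) * indicator (A k) x \<partial>lborel) =
          (\<integral>\<^sup>+x. (\<Sum>k. ennreal ((norm (grad \<phi> x))\<^sup>2) * indicator (A k) x) \<partial>lborel)"
        by (rule nn_integral_suminf[symmetric]) measurable
      \<comment> \<open>The layers are disjoint, so their indicators sum to at most 1.\<close>
      also have "\<dots> \<le> (\<integral>\<^sup>+x. ennreal ((norm (grad \<phi> x))\<^sup>2) \<partial>lborel)"
        by (intro nn_integral_mono) (simp add: suminf_indicator[OF disj] split: split_indicator)
      also note K
      finally have "ennreal P \<le> ennreal (4 powr p) * (ennreal ?c * ennreal K)"
        by (simp add: mult_left_mono)
      also have "\<dots> = ennreal (C * K * P powr (2 / N))"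
        using \<open>K \<ge> 0\<close> by (simp add: C_def mult_ac flip: ennreal_mult')
      finally have "P \<le> C * K * P powr (2 / N)"
        using \<open>K \<ge> 0\<close> C by (subst (asm) ennreal_le_iff) auto
      \<comment> \<open>Division by \<open>P powr (2 / N)\<close> leaves the exponent
        \<open>1 - 2 / N\<close>, whose reciprocal is \<open>N / (N - 2)\<close>.\<close>
      hence "P powr (1 - 2 / N) \<le> C * K"
        using \<open>P > 0\<close> by (simp add: powr_diff divide_le_eq)
      hence "(P powr (1 - 2 / N)) powr (N / (N - 2)) \<le> (C * K) powr (N / (N - 2))"
        using N by (intro powr_mono2) auto
      moreover have "(P powr (1 - 2 / N)) powr (N / (N - 2)) = P"
      proof -
        have "(1 - 2 / N) * (N / (N - 2)) = 1" using N by (simp add: field_simps)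
        thus ?thesis using \<open>P > 0\<close> by (simp only: powr_powr) simp
      qed
      ultimately show ?thesis by (simp only:)
    qed simp
    thus "(\<integral>\<^sup>+x. ennreal (\<bar>\<phi> x\<bar> powr p) \<partial>lborel) \<le> ennreal ((C * K) powr (N / (N - 2)))"
      unfolding P(2) by (rule ennreal_leI)
  qed
qed

subsection \<open>Vanishing of superlevel sets\<close>

lemma tendsto_ennreal_0I:
  fixes f :: "'a \<Rightarrow> ennreal"
  assumes "\<And>e::real. e > 0 \<Longrightarrow> \<forall>\<^sub>F x in F. f x \<le> ennreal e"
  shows "(f \<longlongrightarrow> 0) F"
proof (rule order_tendstoI)
  fix a :: ennreal assume "0 < a"
  then obtain b where b: "0 < b" "b < a" using dense by blast
  then obtain e where e: "b = ennreal e" "e > 0"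
    by (cases b rule: ennreal_cases) auto
  show "\<forall>\<^sub>F x in F. f x < a"
    using assms[OF e(2)] by eventually_elim (use b e in auto)
qed simp

lemma tendsto_ennreal_0D:
  fixes f :: "'a \<Rightarrow> ennreal"
  assumes "(f \<longlongrightarrow> 0) F" "e > 0"
  shows "\<forall>\<^sub>F x in F. f x \<le> ennreal e"
  using order_tendstoD(2)[OF assms(1), of "ennreal e"] assms(2)
  by (auto elim!: eventually_mono)

text \<open>The radius \<open>a\<close> depends on \<open>e\<close> but not on \<open>n\<close>. It
  is at most \<open>r\<close>, so that masses in balls of radius \<open>r\<close> control those in
  balls of radius \<open>a\<close>, and small enough for the gradient term to be at most
  \<open>d\<^sup>2 * e\<close>.\<close>

lemma test_superlevel_vanishes:
  fixes \<phi> :: "nat \<Rightarrow> real ^ 'n::finite \<Rightarrow> real"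
  assumes \<phi>: "\<And>n. \<phi> n \<in> test_functions" and "K \<ge> 0"
    and K: "\<And>n. (\<integral>\<^sup>+x. ennreal ((norm (grad (\<phi> n) x))\<^sup>2) \<partial>lborel) \<le> ennreal K"
    and "r > 0"
    and lim: "(\<lambda>n. SUP y. \<integral>\<^sup>+x \<in> ball y r. ennreal ((\<phi> n x)\<^sup>2) \<partial>lborel) \<longlonglongrightarrow> 0"
    and "d > 0"
  shows "(\<lambda>n. emeasure lborel {x. d \<le> \<bar>\<phi> n x\<bar>}) \<longlonglongrightarrow> 0"
proof (rule tendsto_ennreal_0I)
  fix e :: real assume "e > 0"
  \<comment> \<open>Solves \<open>4 * t\<^sup>2 * (K + 1) = d\<^sup>2 * e\<close>; taking
    \<open>K + 1\<close> for \<open>K\<close> keeps the denominator positive.\<close>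
  define t where "t = sqrt (d\<^sup>2 * e / (4 * (K + 1)))"
  define a where "a = min r t"
  have "t > 0" using \<open>d > 0\<close> \<open>e > 0\<close> \<open>K \<ge> 0\<close> by (simp add: t_def)
  hence a: "a > 0" "a \<le> r" using \<open>r > 0\<close> by (auto simp: a_def)
  have "a\<^sup>2 \<le> t\<^sup>2" using a by (intro power_mono) (auto simp: a_def)
  hence "4 * a\<^sup>2 * K \<le> 4 * t\<^sup>2 * K" using \<open>K \<ge> 0\<close> by (intro mult_right_mono) auto
  also have "\<dots> = d\<^sup>2 * e * (K / (K + 1))"
    using \<open>d > 0\<close> \<open>e > 0\<close> \<open>K \<ge> 0\<close> by (simp add: t_def field_simps)
  also have "\<dots> \<le> d\<^sup>2 * e"
    using \<open>d > 0\<close> \<open>e > 0\<close> \<open>K \<ge> 0\<close> by (intro mult_left_le) auto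
  finally have aK: "4 * a\<^sup>2 * K \<le> d\<^sup>2 * e" .
  define m where "m = unit_ball_vol (real DIM(real ^ 'n)) * a ^ DIM(real ^ 'n)"
  have m: "m > 0" using a by (simp add: m_def)
  have vol: "emeasure lborel (ball (0::real^'n) a) = ennreal m"
    using a by (simp add: emeasure_ball m_def)
  \<comment> \<open>The threshold is the one that \<open>superlevel_measure_le\<close> asks for at
    height \<open>d\<close> and radius \<open>a\<close>; it is positive and independent of
    \<open>n\<close>.\<close>
  have "\<forall>\<^sub>F n in sequentially. (SUP y. \<integral>\<^sup>+x \<in> ball y r. ennreal ((\<phi> n x)\<^sup>2) \<partial>lborel)
      \<le> ennreal (d\<^sup>2 / 4 * m)"
    using m \<open>d > 0\<close> by (intro tendsto_ennreal_0D[OF lim]) auto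
  thus "\<forall>\<^sub>F n in sequentially. emeasure lborel {x. d \<le> \<bar>\<phi> n x\<bar>} \<le> ennreal e"
  proof eventually_elim
    case (elim n)
    have [measurable]: "\<phi> n \<in> borel_measurable borel"
      using \<phi> by (auto intro!: borel_measurable_continuous_onI continuous_on_test_function)
    have "ennreal (d\<^sup>2) * emeasure lborel {x. d \<le> \<bar>\<phi> n x\<bar>} \<le>
      ennreal (4 * a\<^sup>2) * (\<integral>\<^sup>+x. ennreal ((norm (grad (\<phi> n) x))\<^sup>2) \<partial>lborel)"
    proof (rule superlevel_measure_le[OF test_function_has_derivative[OF \<phi>] continuous_on_grad[OF \<phi>]])
      fix x :: "real ^ 'n"
      have "(\<integral>\<^sup>+y. ennreal ((\<phi> n y)\<^sup>2) * indicator (ball x a) y \<partial>lborel) \<le>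
          (\<integral>\<^sup>+y \<in> ball x r. ennreal ((\<phi> n y)\<^sup>2) \<partial>lborel)"
        using a by (intro nn_integral_mono mult_left_mono) (auto split: split_indicator)
      also have "\<dots> \<le> (SUP y. \<integral>\<^sup>+x \<in> ball y r. ennreal ((\<phi> n x)\<^sup>2) \<partial>lborel)"
        by (rule SUP_upper) simp
      also note elim
      finally show "(\<integral>\<^sup>+y. ennreal ((\<phi> n y)\<^sup>2) * indicator (ball x a) y \<partial>lborel)
          \<le> ennreal (d\<^sup>2 / 4) * emeasure lborel (ball (0::real^'n) a)"
        using m by (simp add: vol flip: ennreal_mult')
    qed (use a \<open>d > 0\<close> in auto)
    also have "\<dots> \<le> ennreal (4 * a\<^sup>2) * ennreal K"
      by (intro mult_left_mono K) simp
    also have "\<dots> = ennreal (4 * a\<^sup>2 * K)" by (simp add: ennreal_mult')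
    also have "\<dots> \<le> ennreal (d\<^sup>2 * e)" using aK by (rule ennreal_leI)
    also have "\<dots> = ennreal (d\<^sup>2) * ennreal e" by (simp add: ennreal_mult')
    finally show ?case
      using \<open>d > 0\<close> by (subst (asm) ennreal_mult_le_mult_iff) auto
  qed
qed

section \<open>Approximation of elements of \<open>D12\<close> by test functions\<close>

lemma D12_approx_D12_grad:
  assumes "u \<in> D12"
  shows "\<exists>\<phi>. D12_approx \<phi> u (D12_grad u)"
  using assms someI_ex[of "\<lambda>g. \<exists>\<phi>. D12_approx \<phi> u g"]
  unfolding D12_def D12_grad_def by blast

lemma power2_norm_add_le:
  fixes x y :: "'a::real_normed_vector"
  shows "(norm (x + y))\<^sup>2 \<le> 2 * (norm x)\<^sup>2 + 2 * (norm y)\<^sup>2"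
proof -
  have "(norm (x + y))\<^sup>2 \<le> (norm x + norm y)\<^sup>2"
    by (intro power_mono norm_triangle_ineq) simp
  also have "\<dots> \<le> 2 * (norm x)\<^sup>2 + 2 * (norm y)\<^sup>2"
    using zero_le_power2[of "norm x - norm y"] by (simp add: power2_eq_square algebra_simps)
  finally show ?thesis .
qed

lemma nn_integral_power2_norm_add_le:
  fixes f g :: "'a \<Rightarrow> 'b::euclidean_space"
  assumes [measurable]: "f \<in> borel_measurable M" "g \<in> borel_measurable M"
  shows "(\<integral>\<^sup>+x. ennreal ((norm (f x + g x))\<^sup>2) \<partial>M) \<le>
    2 * (\<integral>\<^sup>+x. ennreal ((norm (f x))\<^sup>2) \<partial>M) + 2 * (\<integral>\<^sup>+x. ennreal ((norm (g x))\<^sup>2) \<partial>M)"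
proof -
  have "(\<integral>\<^sup>+x. ennreal ((norm (f x + g x))\<^sup>2) \<partial>M) \<le>
    (\<integral>\<^sup>+x. 2 * ennreal ((norm (f x))\<^sup>2) + 2 * ennreal ((norm (g x))\<^sup>2) \<partial>M)"
  proof (rule nn_integral_mono)
    fix x
    show "ennreal ((norm (f x + g x))\<^sup>2) \<le> 2 * ennreal ((norm (f x))\<^sup>2) + 2 * ennreal ((norm (g x))\<^sup>2)"
      using ennreal_leI[OF power2_norm_add_le[of "f x" "g x"]] by (simp add: ennreal_mult')
  qed
  thus ?thesis by (simp add: nn_integral_add nn_integral_cmult)
qed

text \<open>This allows replacing a bounded sequence in \<open>D12\<close> by test functions: the
  gradient bound depends on \<open>C\<close> alone, while the error \<open>e\<close> is
  free.\<close>

lemma D12_test_approx: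
  fixes u :: "real ^ 'n::finite \<Rightarrow> real"
  assumes u: "u \<in> D12" and C: "D12_norm u \<le> C" and "e > 0"
  shows "\<exists>\<phi>\<in>test_functions.
    (\<integral>\<^sup>+x. ennreal ((norm (grad \<phi> x))\<^sup>2) \<partial>lborel) \<le> ennreal (2 * C\<^sup>2 + 1) \<and>
    (\<integral>\<^sup>+x. ennreal (\<bar>\<phi> x - u x\<bar> powr crit_exp CARD('n)) \<partial>lebesgue) \<le> ennreal e"
proof -
  obtain \<phi> where "D12_approx \<phi> u (D12_grad u)" using D12_approx_D12_grad[OF u] by blast
  note \<phi> = this[unfolded D12_approx_def]
  define g where "g = D12_grad u"
  have [measurable]: "g \<in> borel_measurable lebesgue" using \<phi> by (simp add: g_def)
  have [measurable]: "grad (\<phi> k) \<in> borel_measurable lebesgue" for k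
    using \<phi> by (intro measurable_completion)
      (auto intro!: borel_measurable_continuous_onI continuous_on_grad)
  let ?h = "\<lambda>k. \<integral>\<^sup>+x. ennreal ((norm (grad (\<phi> k) x - g x))\<^sup>2) \<partial>lebesgue"
  \<comment> \<open>The 1/2 is doubled by the squared triangle inequality and becomes the summand 1
    of the gradient bound.\<close>
  have h: "\<forall>\<^sub>F k in sequentially. ?h k \<le> ennreal (1/2)"
    using \<phi> by (intro tendsto_ennreal_0D) (auto simp: g_def)
  moreover have "\<forall>\<^sub>F k in sequentially.
      (\<integral>\<^sup>+x. ennreal (\<bar>\<phi> k x - u x\<bar> powr crit_exp CARD('n)) \<partial>lebesgue) \<le> ennreal e"
    using \<phi> \<open>e > 0\<close> by (intro tendsto_ennreal_0D) auto
  ultimately have "\<forall>\<^sub>F k in sequentially. ?h k \<le> ennreal (1/2) \<and>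
      (\<integral>\<^sup>+x. ennreal (\<bar>\<phi> k x - u x\<bar> powr crit_exp CARD('n)) \<partial>lebesgue) \<le> ennreal e"
    by (rule eventually_conj)
  then obtain k where k: "?h k \<le> ennreal (1/2)"
      "(\<integral>\<^sup>+x. ennreal (\<bar>\<phi> k x - u x\<bar> powr crit_exp CARD('n)) \<partial>lebesgue) \<le> ennreal e"
    by (auto simp: eventually_sequentially)
  \<comment> \<open>The Bochner integral in \<open>D12_norm\<close> is 0 by default for a
    non-integrable function, so the bound \<open>C\<close> is informative only once \<open>g\<close>
    is known to be square integrable. It is, since it differs from the gradient of a test function
    by a square integrable function.\<close>
  have "(\<integral>\<^sup>+x. ennreal ((norm (g x))\<^sup>2) \<partial>lebesgue) \<le>
      2 * (\<integral>\<^sup>+x. ennreal ((norm (grad (\<phi> k) x))\<^sup>2) \<partial>lebesgue) + 2 * ?h k"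
    using nn_integral_power2_norm_add_le[of "grad (\<phi> k)" lebesgue "\<lambda>x. g x - grad (\<phi> k) x"]
    by (simp add: norm_minus_commute)
  also have "\<dots> < \<infinity>"
  proof -
    have "(\<integral>\<^sup>+x. ennreal ((norm (grad (\<phi> k) x))\<^sup>2) \<partial>lebesgue) < \<infinity>"
      using test_function_grad_integrable[of "\<phi> k"] \<phi> by (simp add: nn_integral_completion)
    moreover have "?h k < \<infinity>" using le_less_trans[OF k(1) ennreal_less_top] by simp
    ultimately show ?thesis by (simp add: ennreal_mult_less_top)
  qed
  finally have "integrable lebesgue (\<lambda>x. (norm (g x))\<^sup>2)"
    by (intro integrableI_nonneg) auto
  hence "(\<integral>\<^sup>+x. ennreal ((norm (g x))\<^sup>2) \<partial>lebesgue) = ennreal (LINT x|lebesgue. (norm (g x))\<^sup>2)"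
    by (intro nn_integral_eq_integral) auto
  also have "\<dots> \<le> ennreal (C\<^sup>2)"
  proof (rule ennreal_leI)
    have "0 \<le> (LINT x|lebesgue. (norm (g x))\<^sup>2)" by simp
    moreover have "sqrt (LINT x|lebesgue. (norm (g x))\<^sup>2) \<le> C"
      using C by (simp add: D12_norm_def g_def)
    ultimately show "(LINT x|lebesgue. (norm (g x))\<^sup>2) \<le> C\<^sup>2"
      by (simp add: sqrt_le_D)
  qed
  finally have gC: "(\<integral>\<^sup>+x. ennreal ((norm (g x))\<^sup>2) \<partial>lebesgue) \<le> ennreal (C\<^sup>2)" .
  have "(\<integral>\<^sup>+x. ennreal ((norm (grad (\<phi> k) x))\<^sup>2) \<partial>lborel)
      = (\<integral>\<^sup>+x. ennreal ((norm (grad (\<phi> k) x))\<^sup>2) \<partial>lebesgue)"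
    by (simp add: nn_integral_completion)
  also have "\<dots> \<le> 2 * ?h k + 2 * (\<integral>\<^sup>+x. ennreal ((norm (g x))\<^sup>2) \<partial>lebesgue)"
    using nn_integral_power2_norm_add_le[of "\<lambda>x. grad (\<phi> k) x - g x" lebesgue g] by simp
  also have "\<dots> \<le> 2 * ennreal (1/2) + 2 * ennreal (C\<^sup>2)"
    by (intro add_mono mult_left_mono k(1) gC) auto
  also have "\<dots> = ennreal (2 * C\<^sup>2 + 1)"
  proof -
    have "2 * ennreal t = ennreal (2 * t)" for t by (simp add: ennreal_mult')
    moreover have "ennreal (2 * (1/2)) + ennreal (2 * C\<^sup>2) = ennreal (2 * C\<^sup>2 + 1)"
      by (subst ennreal_plus[symmetric]) (simp_all add: add.commute)
    ultimately show ?thesis by (simp only:)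
  qed
  finally show ?thesis using k(2) \<phi> by blast
qed

text \<open>Where \<open>t\<^sup>2\<close> exceeds \<open>\<eta>\<close>, it equals
  \<open>(t\<^sup>2) powr (1 - p / 2) * \<bar>t\<bar> powr p\<close>, and the exponent
  \<open>1 - p / 2\<close> is negative. This takes the place of Hoelder's inequality on
  balls.\<close>

lemma power2_le_powr:
  fixes t \<eta> p :: real
  assumes "\<eta> > 0" "p > 2"
  shows "t\<^sup>2 \<le> \<eta> + \<eta> powr (1 - p / 2) * \<bar>t\<bar> powr p"
proof (cases "t\<^sup>2 \<le> \<eta>")
  case True
  thus ?thesis by (simp add: add_increasing2)
next
  case False
  hence "t \<noteq> 0" using assms by auto
  have "(t\<^sup>2) powr (1 - p / 2) \<le> \<eta> powr (1 - p / 2)"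
    using False assms by (intro powr_mono2') auto
  hence "(t\<^sup>2) powr (1 - p / 2) * \<bar>t\<bar> powr p \<le> \<eta> powr (1 - p / 2) * \<bar>t\<bar> powr p"
    by (intro mult_right_mono) auto
  moreover have "(t\<^sup>2) powr (1 - p / 2) * \<bar>t\<bar> powr p = t\<^sup>2"
  proof -
    have "t\<^sup>2 = \<bar>t\<bar> powr 2" using \<open>t \<noteq> 0\<close> by simp
    hence "(t\<^sup>2) powr (1 - p / 2) * \<bar>t\<bar> powr p = \<bar>t\<bar> powr (2 * (1 - p / 2) + p)"
      by (simp only: powr_powr powr_add)
    thus ?thesis using \<open>t \<noteq> 0\<close> by simp
  qed
  ultimately show ?thesis using assms(1) by linarith
qed

text \<open>Closeness in the power \<open>p\<close> carries smallness of local masses over from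
  \<open>u\<close> to \<open>f\<close>. The first two terms do not depend on the centre
  \<open>y\<close>, so the estimate survives a supremum over \<open>y\<close>.\<close>

lemma local_power2_le:
  fixes f u :: "'a::euclidean_space \<Rightarrow> real"
  assumes [measurable]: "f \<in> borel_measurable lebesgue" "u \<in> borel_measurable lebesgue"
    and "\<eta> > 0" "p > 2" "r > 0"
  shows "(\<integral>\<^sup>+x \<in> ball y r. ennreal ((f x)\<^sup>2) \<partial>lebesgue) \<le>
    ennreal (2 * \<eta> * (unit_ball_vol (real DIM('a)) * r ^ DIM('a))) +
    ennreal (2 * \<eta> powr (1 - p / 2)) * (\<integral>\<^sup>+x. ennreal (\<bar>f x - u x\<bar> powr p) \<partial>lebesgue) +
    2 * (\<integral>\<^sup>+x \<in> ball y r. ennreal ((u x)\<^sup>2) \<partial>lebesgue)"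
proof -
  have [measurable]: "ball y r \<in> sets lebesgue" by (intro sets_completionI_sets) auto
  have "(\<integral>\<^sup>+x \<in> ball y r. ennreal ((f x)\<^sup>2) \<partial>lebesgue) \<le>
    (\<integral>\<^sup>+x. (ennreal (2 * \<eta>) * indicator (ball y r) x +
      ennreal (2 * \<eta> powr (1 - p / 2)) * ennreal (\<bar>f x - u x\<bar> powr p)) +
      2 * (ennreal ((u x)\<^sup>2) * indicator (ball y r) x) \<partial>lebesgue)"
  proof (rule nn_integral_mono)
    fix x
    have "(f x)\<^sup>2 \<le> 2 * (f x - u x)\<^sup>2 + 2 * (u x)\<^sup>2"
      using power2_norm_add_le[of "f x - u x" "u x"] by simp
    also have "\<dots> \<le> (2 * \<eta> + 2 * \<eta> powr (1 - p / 2) * \<bar>f x - u x\<bar> powr p) + 2 * (u x)\<^sup>2"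
      using power2_le_powr[OF \<open>\<eta> > 0\<close> \<open>p > 2\<close>, of "f x - u x"] by simp
    finally have "ennreal ((f x)\<^sup>2) \<le>
        ennreal ((2 * \<eta> + 2 * \<eta> powr (1 - p / 2) * \<bar>f x - u x\<bar> powr p) + 2 * (u x)\<^sup>2)"
      by (rule ennreal_leI)
    also have "\<dots> = (ennreal (2 * \<eta>) + ennreal (2 * \<eta> powr (1 - p / 2)) * ennreal (\<bar>f x - u x\<bar> powr p)) +
        2 * ennreal ((u x)\<^sup>2)"
      using \<open>\<eta> > 0\<close> by (simp add: ennreal_mult')
    finally show "ennreal ((f x)\<^sup>2) * indicator (ball y r) x \<le>
        (ennreal (2 * \<eta>) * indicator (ball y r) x +
        ennreal (2 * \<eta> powr (1 - p / 2)) * ennreal (\<bar>f x - u x\<bar> powr p)) +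
        2 * (ennreal ((u x)\<^sup>2) * indicator (ball y r) x)"
      by (auto split: split_indicator)
  qed
  also have "\<dots> = ennreal (2 * \<eta>) * emeasure lebesgue (ball y r) +
    ennreal (2 * \<eta> powr (1 - p / 2)) * (\<integral>\<^sup>+x. ennreal (\<bar>f x - u x\<bar> powr p) \<partial>lebesgue) +
    2 * (\<integral>\<^sup>+x \<in> ball y r. ennreal ((u x)\<^sup>2) \<partial>lebesgue)"
    by (simp add: nn_integral_add nn_integral_cmult nn_integral_cmult_indicator)
  also have "ennreal (2 * \<eta>) * emeasure lebesgue (ball y r) =
      ennreal (2 * \<eta> * (unit_ball_vol (real DIM('a)) * r ^ DIM('a)))"
    using \<open>\<eta> > 0\<close> \<open>r > 0\<close> by (simp add: emeasure_ball ennreal_mult')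
  finally show ?thesis .
qed

section \<open>Pointwise bounds for powers and for \<open>\<Psi>\<close>\<close>

lemma abs_powr_le_add:
  fixes s t p :: real
  assumes "p \<ge> 0"
  shows "\<bar>s\<bar> powr p \<le> 2 powr p * (\<bar>t\<bar> powr p + \<bar>t - s\<bar> powr p)"
proof -
  define m where "m = max \<bar>t\<bar> \<bar>t - s\<bar>"
  have "\<bar>s\<bar> powr p \<le> (2 * m) powr p"
    using assms by (intro powr_mono2) (auto simp: m_def max_def abs_if)
  also have "\<dots> = 2 powr p * m powr p" by (simp add: powr_mult m_def)
  also have "m powr p \<le> \<bar>t\<bar> powr p + \<bar>t - s\<bar> powr p"
    by (auto simp: m_def max_def)
  finally show ?thesis by simp
qed

text \<open>Near 0 and near infinity the limits of the quotient give the first term; on the compact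
  range in between, continuity gives the bound \<open>B\<close>.\<close>

lemma growth_bound_off_origin:
  fixes \<Psi> :: "real \<Rightarrow> real"
  assumes cont: "continuous_on UNIV \<Psi>" and nonneg: "\<And>s. \<Psi> s \<ge> 0" and "p > 0" "e > 0"
    and lim0: "((\<lambda>s. \<Psi> s / \<bar>s\<bar> powr p) \<longlongrightarrow> 0) (at 0)"
    and liminf: "((\<lambda>s. \<Psi> s / \<bar>s\<bar> powr p) \<longlongrightarrow> 0) at_infinity"
  obtains d B where "d > 0" "B \<ge> 0"
    "\<And>s. \<Psi> s \<le> e * \<bar>s\<bar> powr p + B * indicator {s. d \<le> \<bar>s\<bar>} s"
proof -
  \<comment> \<open>The limit \<open>at 0\<close> ignores the point 0 itself; the value there
    follows from continuity.\<close>
  have \<Psi>0: "\<Psi> 0 = 0"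
  proof -
    have "((\<lambda>s::real. \<bar>s\<bar> powr p) \<longlongrightarrow> 0) (at 0)"
      using \<open>p > 0\<close>
      by (intro tendsto_zero_powrI[where b = p] tendsto_rabs_zero tendsto_ident_at tendsto_const) auto
    hence "((\<lambda>s. \<Psi> s / \<bar>s\<bar> powr p * \<bar>s\<bar> powr p) \<longlongrightarrow> 0 * 0) (at 0)"
      by (intro tendsto_mult lim0)
    moreover have "\<forall>\<^sub>F s in at 0. \<Psi> s / \<bar>s\<bar> powr p * \<bar>s\<bar> powr p = \<Psi> s"
      by (auto simp: eventually_at intro!: exI[of _ 1])
    ultimately have "(\<Psi> \<longlongrightarrow> 0) (at 0)"
      by (simp add: tendsto_cong)
    moreover have "(\<Psi> \<longlongrightarrow> \<Psi> 0) (at 0)"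
      using cont by (simp add: continuous_on_eq_continuous_at isContD)
    ultimately show ?thesis
      using tendsto_unique[OF trivial_limit_at] by blast
  qed
  have small: "\<Psi> s \<le> e * \<bar>s\<bar> powr p" if "\<Psi> s / \<bar>s\<bar> powr p < e" "s \<noteq> 0" for s
    using that by (simp add: divide_less_eq)
  have "\<forall>\<^sub>F s in at 0. \<Psi> s / \<bar>s\<bar> powr p < e"
    using lim0 \<open>e > 0\<close> by (rule order_tendstoD)
  then obtain d where d: "d > 0" "\<And>s. s \<noteq> 0 \<Longrightarrow> \<bar>s\<bar> < d \<Longrightarrow> \<Psi> s / \<bar>s\<bar> powr p < e"
    by (auto simp: eventually_at dist_real_def)
  have "\<forall>\<^sub>F s in at_infinity. \<Psi> s / \<bar>s\<bar> powr p < e"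
    using liminf \<open>e > 0\<close> by (rule order_tendstoD)
  then obtain b where b: "\<And>s. b \<le> \<bar>s\<bar> \<Longrightarrow> \<Psi> s / \<bar>s\<bar> powr p < e"
    by (auto simp: eventually_at_infinity)
  \<comment> \<open>The sign of \<open>b\<close> is unknown, hence the absolute value.\<close>
  have "bounded (\<Psi> ` {- \<bar>b\<bar>..\<bar>b\<bar>})"
    by (intro compact_imp_bounded compact_continuous_image continuous_on_subset[OF cont]) auto
  then obtain B where B: "B > 0" "\<forall>y \<in> \<Psi> ` {- \<bar>b\<bar>..\<bar>b\<bar>}. norm y \<le> B"
    unfolding bounded_pos by blast
  have middle: "\<Psi> s \<le> B" if "\<bar>s\<bar> \<le> \<bar>b\<bar>" for s
  proof -
    have "s \<in> {- \<bar>b\<bar>..\<bar>b\<bar>}" using that by auto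
    hence "norm (\<Psi> s) \<le> B" using B(2) by blast
    thus ?thesis by simp
  qed
  show ?thesis
  proof (rule that[OF d(1)])
    show "B \<ge> 0" using B by simp
    fix s :: real
    consider "s = 0" | "s \<noteq> 0" "\<bar>s\<bar> < d" | "d \<le> \<bar>s\<bar>" "\<bar>s\<bar> \<le> \<bar>b\<bar>" | "d \<le> \<bar>s\<bar>" "\<bar>b\<bar> \<le> \<bar>s\<bar>"
      by linarith
    thus "\<Psi> s \<le> e * \<bar>s\<bar> powr p + B * indicator {s. d \<le> \<bar>s\<bar>} s"
    proof cases
      case 1
      thus ?thesis using \<Psi>0 d(1) by simp
    next
      case 2
      thus ?thesis using small[OF d(2)[OF 2] 2(1)] by simp
    next
      case 3
      have "0 \<le> e * \<bar>s\<bar> powr p" using \<open>e > 0\<close> by simp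
      thus ?thesis using 3 middle[of s] by simp
    next
      case 4
      thus ?thesis using small[OF b, of s] d(1) B(1) by (simp add: add_increasing2)
    qed
  qed
qed

section \<open>Integrals of \<open>\<Psi>\<close> along the bounded sequence\<close>

theorem lemma1p6:
  fixes u :: "nat \<Rightarrow> real ^ 'n::finite \<Rightarrow> real"
    and \<Psi> :: "real \<Rightarrow> real"
    and r :: real
  assumes "CARD('n) \<ge> 3"
    and "\<And>n. u n \<in> D12"
    and "\<exists>C. \<forall>n. D12_norm (u n) \<le> C"
    and "r > 0"
    and "(\<lambda>n. SUP y. \<integral>\<^sup>+ x \<in> ball y r. ennreal (\<bar>u n x\<bar>\<^sup>2) \<partial>lebesgue) \<longlonglongrightarrow> 0"
    and "continuous_on UNIV \<Psi>"
    and "\<And>s. \<Psi> s \<ge> 0"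
    and "((\<lambda>s. \<Psi> s / \<bar>s\<bar> powr crit_exp CARD('n)) \<longlongrightarrow> 0) (at 0)"
    and "((\<lambda>s. \<Psi> s / \<bar>s\<bar> powr crit_exp CARD('n)) \<longlongrightarrow> 0) at_infinity"
  shows "(\<lambda>n. \<integral>\<^sup>+ x. ennreal (\<Psi> (u n x)) \<partial>lebesgue) \<longlonglongrightarrow> 0"
proof -
  define N where "N = real CARD('n)"
  define p where "p = crit_exp CARD('n)"
  have "N \<ge> 3" using assms(1) by (simp add: N_def)
  hence p: "p > 2"
    by (simp add: p_def crit_exp_def N_def[symmetric] field_simps)
  have [measurable]: "u n \<in> borel_measurable lebesgue" for n
    using assms(2)[of n] by (auto simp: D12_def D12_approx_def)
  obtain C where C: "\<And>n. D12_norm (u n) \<le> C" using assms(3) by blast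
  define K where "K = 2 * C\<^sup>2 + 1"
  have "K \<ge> 0" by (simp add: K_def)
  \<comment> \<open>One test function is chosen for each \<open>n\<close>, with a common gradient
    bound and an error that tends to 0.\<close>
  have "\<forall>n. \<exists>\<phi>. \<phi> \<in> test_functions \<and>
    (\<integral>\<^sup>+x. ennreal ((norm (grad \<phi> x))\<^sup>2) \<partial>lborel) \<le> ennreal K \<and>
    (\<integral>\<^sup>+x. ennreal (\<bar>\<phi> x - u n x\<bar> powr p) \<partial>lebesgue) \<le> ennreal (1 / real (Suc n))"
    using D12_test_approx[OF assms(2) C] unfolding K_def p_def Bex_def by simp
  from choice[OF this] obtain \<phi> where \<phi>: "\<And>n. \<phi> n \<in> test_functions"
    and grad: "\<And>n. (\<integral>\<^sup>+x. ennreal ((norm (grad (\<phi> n) x))\<^sup>2) \<partial>lborel) \<le> ennreal K"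
    and close: "\<And>n. (\<integral>\<^sup>+x. ennreal (\<bar>\<phi> n x - u n x\<bar> powr p) \<partial>lebesgue) \<le> ennreal (1 / real (Suc n))"
    by blast
  have [measurable]: "\<phi> n \<in> borel_measurable borel" for n
    using \<phi> by (auto intro!: borel_measurable_continuous_onI continuous_on_test_function)
  have [measurable]: "\<phi> n \<in> borel_measurable lebesgue" for n
    by (intro measurable_completion) simp
  have inv0: "(\<lambda>n. c * (1 / real (Suc n))) \<longlonglongrightarrow> 0" for c
    using tendsto_mult[OF tendsto_const LIMSEQ_inverse_real_of_nat, of c] by (simp add: inverse_eq_divide)
  have inv_le: "\<forall>\<^sub>F n in sequentially. c * (1 / real (Suc n)) \<le> e" if "e > 0" for c e
    using order_tendstoD(2)[OF inv0 that, of c] by (auto elim!: eventually_mono)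
  obtain S where S: "\<forall>\<phi> \<in> test_functions. \<forall>K\<ge>0.
    (\<integral>\<^sup>+x. ennreal ((norm (grad \<phi> x))\<^sup>2) \<partial>lborel) \<le> ennreal K \<longrightarrow>
    (\<integral>\<^sup>+x. ennreal (\<bar>\<phi> (x :: real ^ 'n)\<bar> powr p) \<partial>lborel) \<le> ennreal ((S * K) powr (N / (N - 2)))"
    using sobolev_inequality[OF assms(1)] unfolding p_def N_def by blast
  \<comment> \<open>The factor \<open>2 powr p\<close> is that of \<open>abs_powr_le_add\<close>;
    the summands are the Sobolev bound for \<open>\<phi> n\<close> and the bound 1 for the errors
    \<open>1 / real (Suc n)\<close>.\<close>
  define D where "D = 2 powr p * ((S * K) powr (N / (N - 2)) + 1)"
  have D: "D \<ge> 0" by (simp add: D_def)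
  have bound: "(\<integral>\<^sup>+x. ennreal (\<bar>u n x\<bar> powr p) \<partial>lebesgue) \<le> ennreal D" for n
  proof -
    have "(\<integral>\<^sup>+x. ennreal (\<bar>u n x\<bar> powr p) \<partial>lebesgue) \<le>
      (\<integral>\<^sup>+x. ennreal (2 powr p) * (ennreal (\<bar>\<phi> n x\<bar> powr p) + ennreal (\<bar>\<phi> n x - u n x\<bar> powr p)) \<partial>lebesgue)"
      using p by (intro nn_integral_mono)
        (auto simp flip: ennreal_plus ennreal_mult' intro!: ennreal_leI abs_powr_le_add)
    also have "\<dots> = ennreal (2 powr p) * ((\<integral>\<^sup>+x. ennreal (\<bar>\<phi> n x\<bar> powr p) \<partial>lebesgue)
      + (\<integral>\<^sup>+x. ennreal (\<bar>\<phi> n x - u n x\<bar> powr p) \<partial>lebesgue))"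
      by (simp add: nn_integral_cmult nn_integral_add)
    also have "\<dots> \<le> ennreal (2 powr p) * (ennreal ((S * K) powr (N / (N - 2))) + ennreal 1)"
    proof (intro mult_left_mono add_mono)
      show "(\<integral>\<^sup>+x. ennreal (\<bar>\<phi> n x\<bar> powr p) \<partial>lebesgue) \<le> ennreal ((S * K) powr (N / (N - 2)))"
        unfolding nn_integral_completion using S \<phi> grad \<open>K \<ge> 0\<close> by blast
      show "(\<integral>\<^sup>+x. ennreal (\<bar>\<phi> n x - u n x\<bar> powr p) \<partial>lebesgue) \<le> ennreal 1"
        by (rule order_trans[OF close ennreal_leI]) simp
    qed simp
    also have "\<dots> = ennreal D"
      by (simp add: D_def ennreal_mult')
    finally show ?thesis .
  qed
  have lim\<phi>: "(\<lambda>n. SUP y. \<integral>\<^sup>+x \<in> ball y r. ennreal ((\<phi> n x)\<^sup>2) \<partial>lborel) \<longlonglongrightarrow> 0"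
  proof (rule tendsto_ennreal_0I)
    fix e :: real assume "e > 0"
    define m where "m = unit_ball_vol (real DIM(real ^ 'n)) * r ^ DIM(real ^ 'n)"
    have m: "m > 0" using \<open>r > 0\<close> by (simp add: m_def)
    \<comment> \<open>Makes \<open>2 * \<eta> * m\<close> equal to \<open>e / 3\<close>. The
      approximation error and the doubled local mass of \<open>u n\<close> take at most another
      third each.\<close>
    define \<eta> where "\<eta> = e / (6 * m)"
    have \<eta>: "\<eta> > 0" using m \<open>e > 0\<close> by (simp add: \<eta>_def)
    have "\<forall>\<^sub>F n in sequentially. 2 * \<eta> powr (1 - p / 2) * (1 / real (Suc n)) \<le> e / 3"
      using \<open>e > 0\<close> by (intro inv_le) simp
    moreover have "\<forall>\<^sub>F n in sequentially.
        (SUP y. \<integral>\<^sup>+ x \<in> ball y r. ennreal (\<bar>u n x\<bar>\<^sup>2) \<partial>lebesgue) \<le> ennreal (e / 6)"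
      using \<open>e > 0\<close> by (intro tendsto_ennreal_0D[OF assms(5)]) simp
    ultimately show "\<forall>\<^sub>F n in sequentially.
        (SUP y. \<integral>\<^sup>+x \<in> ball y r. ennreal ((\<phi> n x)\<^sup>2) \<partial>lborel) \<le> ennreal e"
    proof eventually_elim
      case (elim n)
      show ?case
      proof (rule SUP_least)
        fix y
        have "(\<integral>\<^sup>+x \<in> ball y r. ennreal ((\<phi> n x)\<^sup>2) \<partial>lborel) =
            (\<integral>\<^sup>+x \<in> ball y r. ennreal ((\<phi> n x)\<^sup>2) \<partial>lebesgue)"
          by (simp add: nn_integral_completion)
        also have "\<dots> \<le> ennreal (2 * \<eta> * m) +
          ennreal (2 * \<eta> powr (1 - p / 2)) * (\<integral>\<^sup>+x. ennreal (\<bar>\<phi> n x - u n x\<bar> powr p) \<partial>lebesgue) +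
          2 * (\<integral>\<^sup>+x \<in> ball y r. ennreal ((u n x)\<^sup>2) \<partial>lebesgue)"
          unfolding m_def using \<eta> p \<open>r > 0\<close> by (intro local_power2_le) auto
        also have "\<dots> \<le> ennreal (2 * \<eta> * m) +
          ennreal (2 * \<eta> powr (1 - p / 2)) * ennreal (1 / real (Suc n)) + ennreal 2 * ennreal (e / 6)"
        proof (intro add_mono mult_mono close order_refl)
          have "(\<integral>\<^sup>+x \<in> ball y r. ennreal ((u n x)\<^sup>2) \<partial>lebesgue) \<le>
              (SUP y. \<integral>\<^sup>+ x \<in> ball y r. ennreal (\<bar>u n x\<bar>\<^sup>2) \<partial>lebesgue)"
            by (rule SUP_upper2[of y]) auto
          thus "(\<integral>\<^sup>+x \<in> ball y r. ennreal ((u n x)\<^sup>2) \<partial>lebesgue) \<le> ennreal (e / 6)"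
            using elim(2) by (rule order_trans)
        qed auto
        also have "\<dots> = ennreal (2 * \<eta> * m + 2 * \<eta> powr (1 - p / 2) * (1 / real (Suc n)) + 2 * (e / 6))"
          using \<eta> m \<open>e > 0\<close> ennreal_mult'[of 2 "e / 6"] by (simp add: ennreal_mult'[symmetric])
        also have "\<dots> \<le> ennreal e"
          using elim(1) m by (intro ennreal_leI) (simp add: \<eta>_def)
        finally show "(\<integral>\<^sup>+x \<in> ball y r. ennreal ((\<phi> n x)\<^sup>2) \<partial>lborel) \<le> ennreal e" .
      qed
    qed
  qed
  have vanish: "(\<lambda>n. emeasure lebesgue {x. d \<le> \<bar>u n x\<bar>}) \<longlonglongrightarrow> 0" if "d > 0" for d
  proof (rule tendsto_ennreal_0I)
    fix e :: real assume "e > 0"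
    have "\<forall>\<^sub>F n in sequentially. emeasure lborel {x. d / 2 \<le> \<bar>\<phi> n x\<bar>} \<le> ennreal (e / 2)"
      using \<open>e > 0\<close> \<open>d > 0\<close>
      by (intro tendsto_ennreal_0D test_superlevel_vanishes[OF \<phi> \<open>K \<ge> 0\<close> grad \<open>r > 0\<close> lim\<phi>]) auto
    moreover have "\<forall>\<^sub>F n in sequentially. (d / 2) powr - p * (1 / real (Suc n)) \<le> e / 2"
      using \<open>e > 0\<close> by (intro inv_le) simp
    ultimately show "\<forall>\<^sub>F n in sequentially. emeasure lebesgue {x. d \<le> \<bar>u n x\<bar>} \<le> ennreal e"
    proof eventually_elim
      case (elim n)
      \<comment> \<open>Where \<open>\<bar>u n x\<bar>\<close> is at least \<open>d\<close>, either
        \<open>\<phi> n\<close> or the difference is at least \<open>d / 2\<close> in absolute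
        value. The first set is small by \<open>test_superlevel_vanishes\<close>, the second by
        Chebyshev's inequality.\<close>
      let ?A = "{x. d / 2 \<le> \<bar>\<phi> n x\<bar>}" and ?B = "{x \<in> space lebesgue. d / 2 \<le> \<bar>\<phi> n x - u n x\<bar>}"
      have A: "?A \<in> sets borel" by measurable
      hence A': "?A \<in> sets lebesgue" by (simp add: sets_completionI_sets)
      have B: "?B \<in> sets lebesgue" by measurable
      have "emeasure lebesgue {x. d \<le> \<bar>u n x\<bar>} \<le> emeasure lebesgue (?A \<union> ?B)"
      proof (rule emeasure_mono)
        show "{x. d \<le> \<bar>u n x\<bar>} \<subseteq> ?A \<union> ?B"
        proof
          fix x assume "x \<in> {x. d \<le> \<bar>u n x\<bar>}"
          hence "d / 2 \<le> \<bar>\<phi> n x\<bar> \<or> d / 2 \<le> \<bar>\<phi> n x - u n x\<bar>" unfolding mem_Collect_eq by argo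
          thus "x \<in> ?A \<union> ?B" by simp
        qed
        show "?A \<union> ?B \<in> sets lebesgue" using A' B by (rule sets.Un)
      qed
      also have "\<dots> \<le> emeasure lebesgue ?A + emeasure lebesgue ?B"
        using A' B by (rule emeasure_subadditive)
      also have "\<dots> \<le> ennreal (e / 2) + ennreal (e / 2)"
      proof (rule add_mono)
        show "emeasure lebesgue ?A \<le> ennreal (e / 2)" using elim(1) A by simp
        have "emeasure lebesgue ?B \<le>
            ennreal ((d / 2) powr - p) * (\<integral>\<^sup>+x. ennreal (\<bar>\<phi> n x - u n x\<bar> powr p) \<partial>lebesgue)"
          using \<open>d > 0\<close> p by (intro superlevel_powr_le) auto
        also have "\<dots> \<le> ennreal ((d / 2) powr - p) * ennreal (1 / real (Suc n))"
          by (intro mult_left_mono close) simp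
        also have "\<dots> = ennreal ((d / 2) powr - p * (1 / real (Suc n)))"
          by (rule ennreal_mult'[symmetric]) simp
        also have "\<dots> \<le> ennreal (e / 2)" using elim(2) by (rule ennreal_leI)
        finally show "emeasure lebesgue ?B \<le> ennreal (e / 2)" .
      qed
      also have "\<dots> = ennreal e" using \<open>e > 0\<close> by (subst ennreal_plus[symmetric]) auto
      finally show ?case .
    qed
  qed
  show ?thesis
  proof (rule tendsto_ennreal_0I)
    fix e :: real assume "e > 0"
    \<comment> \<open>Since \<open>D\<close> bounds the integrals of the critical power for all
      \<open>n\<close>, the first term of the growth bound contributes at most \<open>e / 2\<close>.
      Adding 1 keeps the denominator positive, here and with \<open>B + 1\<close> below.\<close>
    define e' where "e' = e / (2 * (D + 1))"
    have e': "e' > 0" using D \<open>e > 0\<close> by (simp add: e'_def)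
    have "p > 0" using p by simp
    obtain d B where d: "d > 0" "B \<ge> 0"
      "\<And>s. \<Psi> s \<le> e' * \<bar>s\<bar> powr p + B * indicator {s. d \<le> \<bar>s\<bar>} s"
      using growth_bound_off_origin[OF assms(6,7) \<open>p > 0\<close> e' assms(8,9)[folded p_def]] by blast
    have "\<forall>\<^sub>F n in sequentially. emeasure lebesgue {x. d \<le> \<bar>u n x\<bar>} \<le> ennreal (e / (2 * (B + 1)))"
      using \<open>e > 0\<close> d by (intro tendsto_ennreal_0D vanish) auto
    thus "\<forall>\<^sub>F n in sequentially. (\<integral>\<^sup>+ x. ennreal (\<Psi> (u n x)) \<partial>lebesgue) \<le> ennreal e"
    proof eventually_elim
      case (elim n)
      have A: "{x. d \<le> \<bar>u n x\<bar>} \<in> sets lebesgue"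
        using measurable_sets[of "\<lambda>x. \<bar>u n x\<bar>" lebesgue borel "{d..}"] by (simp add: vimage_def)
      have "(\<integral>\<^sup>+ x. ennreal (\<Psi> (u n x)) \<partial>lebesgue) \<le>
        (\<integral>\<^sup>+ x. ennreal e' * ennreal (\<bar>u n x\<bar> powr p) + ennreal B * indicator {x. d \<le> \<bar>u n x\<bar>} x \<partial>lebesgue)"
      proof (rule nn_integral_mono)
        fix x
        have "ennreal (\<Psi> (u n x)) \<le> ennreal (e' * \<bar>u n x\<bar> powr p + B * indicator {s. d \<le> \<bar>s\<bar>} (u n x))"
          by (intro ennreal_leI d)
        also have "\<dots> = ennreal e' * ennreal (\<bar>u n x\<bar> powr p) + ennreal B * indicator {x. d \<le> \<bar>u n x\<bar>} x"
          using e' d(2) by (simp add: ennreal_mult' split: split_indicator)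
        finally show "ennreal (\<Psi> (u n x)) \<le>
            ennreal e' * ennreal (\<bar>u n x\<bar> powr p) + ennreal B * indicator {x. d \<le> \<bar>u n x\<bar>} x" .
      qed
      also have "\<dots> = ennreal e' * (\<integral>\<^sup>+ x. ennreal (\<bar>u n x\<bar> powr p) \<partial>lebesgue) +
          ennreal B * emeasure lebesgue {x. d \<le> \<bar>u n x\<bar>}"
        using A by (simp add: nn_integral_add nn_integral_cmult nn_integral_cmult_indicator)
      also have "\<dots> \<le> ennreal e' * ennreal D + ennreal B * ennreal (e / (2 * (B + 1)))"
        by (intro add_mono mult_left_mono bound elim) auto
      also have "\<dots> = ennreal (e' * D + B * (e / (2 * (B + 1))))"
        using e' d D \<open>e > 0\<close> by (simp add: ennreal_mult'[symmetric])
      also have "\<dots> \<le> ennreal e"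
      proof (rule ennreal_leI)
        have "e' * D = e / 2 * (D / (D + 1))" by (simp add: e'_def)
        also have "\<dots> \<le> e / 2" using D \<open>e > 0\<close> by (intro mult_left_le) auto
        finally have "e' * D \<le> e / 2" .
        moreover have "B * (e / (2 * (B + 1))) = e / 2 * (B / (B + 1))" by simp
        moreover have "\<dots> \<le> e / 2" using d \<open>e > 0\<close> by (intro mult_left_le) auto
        ultimately show "e' * D + B * (e / (2 * (B + 1))) \<le> e" by linarith
      qed
      finally show ?case .
    qed
  qed
qed

end
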